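(* For every $n\ge 3$, every connected non-homotopic $n$-vertex $1$-planar graph has at most $4n-8$ edges.
   Context: Graphs are finite and have no loops, but may have parallel edges. A drawing on the sphere $\mathbb{S}^2$ maps vertices to pairwise distinct points and each edge to a simple Jordan arc joining its endpoints, such that no edge passes through a vertex, any two edges have finitely many common points, every common interior point of two edges is a proper crossing, and no three edges pass through the same crossing. A drawing is $k$-planar if every edge has at most $k$ crossings. A lens is a region bounded by a simple closed curve consisting of exactly two contiguous parts, each being (a part of) a single edge (e.g. two uncrossed parallel edges, parts of two adjacent edges that cross, or parts of two edges crossing more than once); a drawing is non-homotopic if every lens contains a vertex or a crossing in its interior. A non-homotopic $k$-planar graph is a graph admitting a drawing that is both non-homotopic and $k$-planar. *)

theory Defs
  imports "HOL-Analysis.Analysis"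
begin

definition S2 :: "(real^3) set" where
  "S2 = sphere 0 1"

definition multigraph :: "'v set \<Rightarrow> 'e set \<Rightarrow> ('e \<Rightarrow> 'v) \<Rightarrow> ('e \<Rightarrow> 'v) \<Rightarrow> bool" where
  "multigraph V E src tgt \<longleftrightarrow> finite V \<and> finite E \<and>
     (\<forall>e\<in>E. src e \<in> V \<and> tgt e \<in> V \<and> src e \<noteq> tgt e)"

definition adjacent :: "'e set \<Rightarrow> ('e \<Rightarrow> 'v) \<Rightarrow> ('e \<Rightarrow> 'v) \<Rightarrow> 'v \<Rightarrow> 'v \<Rightarrow> bool" where
  "adjacent E src tgt u v \<longleftrightarrow> (\<exists>e\<in>E. {src e, tgt e} = {u, v})"

definition connected_graph :: "'v set \<Rightarrow> 'e set \<Rightarrow> ('e \<Rightarrow> 'v) \<Rightarrow> ('e \<Rightarrow> 'v) \<Rightarrow> bool" where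
  "connected_graph V E src tgt \<longleftrightarrow> (\<forall>u\<in>V. \<forall>v\<in>V. (adjacent E src tgt)\<^sup>*\<^sup>* u v)"

definition arc_interior :: "(real \<Rightarrow> real^3) \<Rightarrow> (real^3) set" where
  "arc_interior g = g ` {0<..<1}"

definition proper_crossing :: "(real \<Rightarrow> real^3) \<Rightarrow> (real \<Rightarrow> real^3) \<Rightarrow> real^3 \<Rightarrow> bool" where
  "proper_crossing g h p \<longleftrightarrow>
     (\<exists>U \<phi> \<psi>. openin (top_of_set S2) U \<and> p \<in> U \<and>
        homeomorphism U (ball (0::complex) 1) \<phi> \<psi> \<and> \<phi> p = 0 \<and>
        \<phi> ` (U \<inter> path_image g) = ball 0 1 \<inter> {z. Im z = 0} \<and>
        \<phi> ` (U \<inter> path_image h) = ball 0 1 \<inter> {z. Re z = 0})"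

definition drawing ::
  "'v set \<Rightarrow> 'e set \<Rightarrow> ('e \<Rightarrow> 'v) \<Rightarrow> ('e \<Rightarrow> 'v) \<Rightarrow> ('v \<Rightarrow> real^3) \<Rightarrow> ('e \<Rightarrow> real \<Rightarrow> real^3) \<Rightarrow> bool" where
  "drawing V E src tgt pos \<gamma> \<longleftrightarrow>
     inj_on pos V \<and> pos ` V \<subseteq> S2 \<and>
     (\<forall>e\<in>E. arc (\<gamma> e) \<and> path_image (\<gamma> e) \<subseteq> S2 \<and>
        pathstart (\<gamma> e) = pos (src e) \<and> pathfinish (\<gamma> e) = pos (tgt e)) \<and>
     (\<forall>e\<in>E. \<forall>v\<in>V. pos v \<notin> arc_interior (\<gamma> e)) \<and>
     (\<forall>e\<in>E. \<forall>f\<in>E. e \<noteq> f \<longrightarrow> finite (path_image (\<gamma> e) \<inter> path_image (\<gamma> f))) \<and>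
     (\<forall>e\<in>E. \<forall>f\<in>E. e \<noteq> f \<longrightarrow>
        (\<forall>p \<in> arc_interior (\<gamma> e) \<inter> arc_interior (\<gamma> f). proper_crossing (\<gamma> e) (\<gamma> f) p)) \<and>
     (\<forall>e\<in>E. \<forall>f\<in>E. \<forall>g\<in>E. e \<noteq> f \<and> e \<noteq> g \<and> f \<noteq> g \<longrightarrow>
        arc_interior (\<gamma> e) \<inter> arc_interior (\<gamma> f) \<inter> path_image (\<gamma> g) = {})"

definition crossings_on :: "'e set \<Rightarrow> ('e \<Rightarrow> real \<Rightarrow> real^3) \<Rightarrow> 'e \<Rightarrow> (real^3) set" where
  "crossings_on E \<gamma> e = {p \<in> arc_interior (\<gamma> e). \<exists>f\<in>E. f \<noteq> e \<and> p \<in> arc_interior (\<gamma> f)}"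

definition crossing_points :: "'e set \<Rightarrow> ('e \<Rightarrow> real \<Rightarrow> real^3) \<Rightarrow> (real^3) set" where
  "crossing_points E \<gamma> = (\<Union>e\<in>E. crossings_on E \<gamma> e)"

definition k_planar_drawing :: "nat \<Rightarrow> 'e set \<Rightarrow> ('e \<Rightarrow> real \<Rightarrow> real^3) \<Rightarrow> bool" where
  "k_planar_drawing k E \<gamma> \<longleftrightarrow> (\<forall>e\<in>E. finite (crossings_on E \<gamma> e) \<and> card (crossings_on E \<gamma> e) \<le> k)"

definition lens_boundary :: "'e set \<Rightarrow> ('e \<Rightarrow> real \<Rightarrow> real^3) \<Rightarrow> (real^3) set \<Rightarrow> bool" where
  "lens_boundary E \<gamma> C \<longleftrightarrow>
     (\<exists>e\<in>E. \<exists>f\<in>E. \<exists>a b c d. 0 \<le> a \<and> a < b \<and> b \<le> 1 \<and> 0 \<le> c \<and> c < d \<and> d \<le> 1 \<and>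
        {\<gamma> e a, \<gamma> e b} = {\<gamma> f c, \<gamma> f d} \<and>
        path_image (subpath a b (\<gamma> e)) \<inter> path_image (subpath c d (\<gamma> f)) = {\<gamma> e a, \<gamma> e b} \<and>
        C = path_image (subpath a b (\<gamma> e)) \<union> path_image (subpath c d (\<gamma> f)))"

definition non_homotopic_drawing ::
  "'v set \<Rightarrow> 'e set \<Rightarrow> ('v \<Rightarrow> real^3) \<Rightarrow> ('e \<Rightarrow> real \<Rightarrow> real^3) \<Rightarrow> bool" where
  "non_homotopic_drawing V E pos \<gamma> \<longleftrightarrow>
     (\<forall>C. lens_boundary E \<gamma> C \<longrightarrow>
        (\<forall>L \<in> components (S2 - C). L \<inter> (pos ` V \<union> crossing_points E \<gamma>) \<noteq> {}))"

definition non_homotopic_k_planar ::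
  "nat \<Rightarrow> 'v set \<Rightarrow> 'e set \<Rightarrow> ('e \<Rightarrow> 'v) \<Rightarrow> ('e \<Rightarrow> 'v) \<Rightarrow> bool" where
  "non_homotopic_k_planar k V E src tgt \<longleftrightarrow>
     (\<exists>pos \<gamma>. drawing V E src tgt pos \<gamma> \<and> k_planar_drawing k E \<gamma> \<and>
              non_homotopic_drawing V E pos \<gamma>)"

end

theory Submission
  imports Defs
begin

text \<open>
  Split every crossed edge at its crossing and project the sphere to the plane from a point off the
  drawing. With \<open>U\<close> uncrossed edges and \<open>X\<close> crossings, the resulting plane graph has
  \<open>n + X\<close> nodes and \<open>U + 4 * X\<close> edges, hence at least \<open>U + 3 * X - n + 2\<close> faces. Give weight 6 to an
  uncrossed edge and 5 to half of a crossed edge, once for each of its two sides. Every face receives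
  at least 16: since lenses are not empty it has at least three sides, and three halves cannot bound
  a face, because each half joins a crossing to a vertex. So \<open>8 * F \<le> 6 * U + 5 * 4 * X\<close>, and together with the bound
  on the number \<open>F\<close> of faces this is the claim for \<open>U + 2 * X\<close> edges.

  No facial walks are needed. By Janiszewski's theorem the two sides of an edge lie in the same face if
  the edge is a bridge, and in exactly two faces otherwise; moreover an edge that separates two faces
  is not a bridge of the boundary graph of either.
\<close>

text \<open>The weights are forced. With weight a on each side of an uncrossed edge, b on each side
  of a half and at least w on every face, the face bound turns into (w - 2a)U + (3w - 8b)X <= w(n -
  2). This is a multiple of U + 2X <= 4n - 8 exactly if a = 3w/8 and b = 5w/16, and w = 16 clears
  the denominators. Faces with one uncrossed side and two halves are tight: 6 + 5 + 5 = 16.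

  Faces with few border edges are the obstacle. For three halves the bipartition alone is not
  enough: it shows that each half has a parallel one among the other two, so that all three are
  parallel, and only the ban on three edges through one crossing excludes this.

  Connectedness of the graph makes every vertex an end of some segment. Hence a vertex inside a lens
  announces an edge that runs into it, and a face cannot fill the lens.\<close>

locale arc_system =
  fixes A :: "'s set" and c :: "'s \<Rightarrow> real \<Rightarrow> complex"
  assumes finite_A: "finite A"
    and arc_A: "s \<in> A \<Longrightarrow> arc (c s)"
    and meet: "\<lbrakk>s \<in> A; t \<in> A; s \<noteq> t\<rbrakk> \<Longrightarrow>
      path_image (c s) \<inter> path_image (c t) \<subseteq> {pathstart (c s), pathfinish (c s)}"
begin

abbreviation seg where "seg s \<equiv> path_image (c s)"

definition ends where "ends s = {pathstart (c s), pathfinish (c s)}"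

definition oseg where "oseg s = seg s - ends s"

definition G where "G B = (\<Union>s\<in>B. seg s)"

definition nodes where "nodes B = (\<Union>s\<in>B. ends s)"

definition faces where "faces B = components (- G B)"

text \<open>Touching \<open>s\<close> only at a node does not count; one common point with the open
  edge suffices.\<close>

definition inc where "inc B s = {f \<in> faces B. closure f \<inter> oseg s \<noteq> {}}"

definition bdry where "bdry B f = {s \<in> B. closure f \<inter> oseg s \<noteq> {}}"

definition link where "link B = (\<lambda>u v. \<exists>s\<in>B. ends s = {u, v})\<^sup>*\<^sup>*"

definition bridge where "bridge B s \<longleftrightarrow> \<not> link (B - {s}) (pathstart (c s)) (pathfinish (c s))"

section \<open>Topology of arcs and of their union\<close>

lemma ends_subset: "ends s \<subseteq> seg s"
  by (auto simp: ends_def)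

lemma finite_ends [simp]: "finite (ends s)"
  by (simp add: ends_def)

lemma seg_split: "seg s = oseg s \<union> ends s"
  using ends_subset by (auto simp: oseg_def)

text \<open>The assumption \<open>meet\<close> names only the ends of \<open>s\<close>; its instance
  with \<open>s\<close> and \<open>t\<close> exchanged supplies those of \<open>t\<close>.\<close>

lemma meet_ends: "\<lbrakk>s \<in> A; t \<in> A; s \<noteq> t\<rbrakk> \<Longrightarrow> seg s \<inter> seg t \<subseteq> ends s \<inter> ends t"
  using meet[of s t] meet[of t s] by (auto simp: ends_def)

lemma oseg_seg_disjoint: "\<lbrakk>s \<in> A; t \<in> A; s \<noteq> t\<rbrakk> \<Longrightarrow> oseg s \<inter> seg t = {}"
  using meet_ends[of s t] by (auto simp: oseg_def)

lemma ends_distinct: "s \<in> A \<Longrightarrow> pathstart (c s) \<noteq> pathfinish (c s)"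
  using arc_distinct_ends[OF arc_A] by metis

lemma oseg_nodes_disjoint:
  assumes "s \<in> A" "B \<subseteq> A" shows "oseg s \<inter> nodes B = {}"
proof -
  have "oseg s \<inter> ends t = {}" if "t \<in> A" for t
    using oseg_seg_disjoint[OF assms(1) that] ends_subset[of t] by (cases "t = s") (auto simp: oseg_def)
  then show ?thesis using assms by (auto simp: nodes_def)
qed

lemma oseg_image: assumes "s \<in> A" shows "oseg s = c s ` {0<..<1}"
proof -
  have inj: "inj_on (c s) {0..1}" using arc_A[OF assms] by (simp add: arc_def)
  have "c s ` {0<..<1} = c s ` ({0..1} - {0,1})" 
    by (rule arg_cong[where f="image (c s)"]) auto
  also have "\<dots> = c s ` {0..1} - c s ` {0,1}"
    by (rule inj_on_image_set_diff[OF inj]) auto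
  finally show ?thesis by (auto simp: oseg_def ends_def path_image_def pathstart_def pathfinish_def)
qed

lemma connected_oseg: assumes "s \<in> A" shows "connected (oseg s)"
proof -
  have "continuous_on {0<..<1} (c s)"
    using arc_A[OF assms] unfolding arc_def path_def by (auto elim!: continuous_on_subset)
  then show ?thesis by (simp add: oseg_image[OF assms] connected_continuous_image)
qed

lemma oseg_nonempty: "s \<in> A \<Longrightarrow> oseg s \<noteq> {}"
  by (simp add: oseg_image)

lemma closure_oseg: assumes "s \<in> A" shows "closure (oseg s) = seg s"
proof -
  have 1: "closure (oseg s) \<subseteq> seg s"
    using arc_A[OF assms] by (intro closure_minimal) (auto simp: oseg_def closed_arc_image)
  have "continuous_on (closure {0<..<1::real}) (c s)"
    using arc_A[OF assms] by (simp add: arc_def path_def)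
  then have "c s ` closure {0<..<1} \<subseteq> closure (c s ` {0<..<1})"
    by (rule image_closure_subset) (auto simp: closure_subset)
  then have "seg s \<subseteq> closure (oseg s)"
    by (simp add: path_image_def oseg_image[OF assms])
  with 1 show ?thesis by auto
qed

lemma compact_G: "B \<subseteq> A \<Longrightarrow> compact (G B)"
  unfolding G_def using finite_subset[OF _ finite_A] arc_A
  by (intro compact_UN) (auto intro!: compact_arc_image)

lemma closed_G: "B \<subseteq> A \<Longrightarrow> closed (G B)"
  by (simp add: compact_G compact_imp_closed)

lemma finite_nodes: "B \<subseteq> A \<Longrightarrow> finite (nodes B)"
  unfolding nodes_def using finite_subset[OF _ finite_A] by simp

lemma nodes_subset_G: "nodes B \<subseteq> G B"
  using ends_subset by (auto simp: nodes_def G_def)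

lemma G_split: "G B = nodes B \<union> (\<Union>s\<in>B. oseg s)"
  using seg_split by (auto simp: nodes_def G_def)

lemma oseg_G_disjoint: "\<lbrakk>s \<in> A; B \<subseteq> A; s \<notin> B\<rbrakk> \<Longrightarrow> oseg s \<inter> G B = {}"
  using oseg_seg_disjoint by (fastforce simp: G_def)

lemma G_insert: "s \<in> B \<Longrightarrow> G B = G (B - {s}) \<union> seg s"
  by (auto simp: G_def)

section \<open>Reachability along edges\<close>

lemma link_refl [simp]: "link B u u"
  by (simp add: link_def)

lemma link_trans: "\<lbrakk>link B u v; link B v w\<rbrakk> \<Longrightarrow> link B u w"
  by (simp add: link_def)

lemma link_edge: "\<lbrakk>s \<in> B; ends s = {u, v}\<rbrakk> \<Longrightarrow> link B u v"
  unfolding link_def by (rule r_into_rtranclp) blast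

lemma link_induct [consumes 1, case_names refl step]:
  assumes "link B u v" "P u"
    "\<And>y z s. \<lbrakk>link B u y; s \<in> B; ends s = {y, z}; P y\<rbrakk> \<Longrightarrow> P z"
  shows "P v"
  using assms(1) unfolding link_def
proof (induction rule: rtranclp_induct)
  case (step y z)
  then show ?case using assms(3)[of y _ z] by (auto simp: link_def)
qed (rule assms(2))

lemma link_sym: "link B u v \<Longrightarrow> link B v u"
proof (induction rule: link_induct)
  case (step y z s)
  then have "link B z y" by (intro link_edge[of s]) auto
  then show ?case using step by (blast intro: link_trans)
qed simp

lemma link_mono: "\<lbrakk>link B u v; B \<subseteq> C\<rbrakk> \<Longrightarrow> link C u v"
proof (induction rule: link_induct)
  case (step y z s)
  then have "link C y z" by (intro link_edge[of s]) auto
  then show ?case using step by (blast intro: link_trans)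
qed simp

lemma link_step: "s \<in> B \<Longrightarrow> link B (pathstart (c s)) (pathfinish (c s))"
  by (rule link_edge) (auto simp: ends_def)

subsection \<open>Bridges and cycles\<close>

text \<open>The rest of the graph falls into the edges reachable from the start of \<open>s\<close>
  and the others. These two closed sets are disjoint, and \<open>seg s\<close> touches the first at
  most in its start and the second at most in its finish, so both intersections are connected as
  Janiszewski's theorem demands.\<close>

lemma bridge_not_separating:
  assumes B: "B \<subseteq> A" "s \<in> B" "bridge B s"
    and xy: "connected_component (- G (B - {s})) x y" "x \<notin> seg s" "y \<notin> seg s"
  shows "connected_component (- G B) x y"
proof -
  let ?a = "pathstart (c s)" and ?b = "pathfinish (c s)"
  \<comment> \<open>Testing only \<open>pathstart (c t)\<close> is enough: \<open>t\<close> itself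
    belongs to \<open>B - {s}\<close>, so its two ends are reachable together or not at all.\<close>
  define B1 where "B1 = {t \<in> B - {s}. link (B - {s}) ?a (pathstart (c t))}"
  define B2 where "B2 = B - {s} - B1"
  have sub: "B1 \<subseteq> A" "B2 \<subseteq> A" using B by (auto simp: B1_def B2_def)
  have B12: "B - {s} = B1 \<union> B2" by (auto simp: B1_def B2_def)
  have reach: "link (B - {s}) ?a u" if "t \<in> B1" "u \<in> ends t" for t u
  proof -
    have "t \<in> B - {s}" "link (B - {s}) ?a (pathstart (c t))" using that by (auto simp: B1_def)
    then show ?thesis using that(2) link_step[of t "B - {s}"]
      by (auto simp: ends_def intro: link_trans)
  qed
  have unreach: "\<not> link (B - {s}) ?a u" if "t \<in> B2" "u \<in> ends t" for t u
  proof
    assume *: "link (B - {s}) ?a u"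
    have t: "t \<in> B - {s}" "\<not> link (B - {s}) ?a (pathstart (c t))" using that by (auto simp: B1_def B2_def)
    have "link (B - {s}) u (pathstart (c t))"
      using that(2) link_step[OF t(1)] link_sym by (auto simp: ends_def)
    with * t(2) show False by (blast intro: link_trans)
  qed
  have disj: "G B1 \<inter> G B2 = {}"
  proof -
    have False if "t1 \<in> B1" "t2 \<in> B2" "p \<in> seg t1" "p \<in> seg t2" for t1 t2 p
    proof -
      have "t1 \<noteq> t2" using that by (auto simp: B1_def B2_def)
      then have "p \<in> ends t1" "p \<in> ends t2" using meet_ends[of t1 t2] that sub by blast+
      then show False using reach unreach that by blast
    qed
    then show ?thesis by (auto simp: G_def)
  qed
  have sA: "s \<in> A" using B by auto
  have e1: "seg s \<inter> G B1 \<subseteq> {?a}"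
  proof
    fix p assume "p \<in> seg s \<inter> G B1"
    then obtain t where t: "t \<in> B1" "p \<in> seg t" "p \<in> seg s" by (auto simp: G_def)
    then have "t \<in> A" "t \<noteq> s" using B by (auto simp: B1_def)
    then have p: "p \<in> ends s" "p \<in> ends t" using meet_ends[of s t] sA t by blast+
    have "p \<noteq> ?b" using reach[OF t(1) p(2)] B(3) by (auto simp: bridge_def)
    then show "p \<in> {?a}" using p by (auto simp: ends_def)
  qed
  have e2: "seg s \<inter> G B2 \<subseteq> {?b}"
  proof
    fix p assume "p \<in> seg s \<inter> G B2"
    then obtain t where t: "t \<in> B2" "p \<in> seg t" "p \<in> seg s" by (auto simp: G_def)
    then have "t \<in> A" "t \<noteq> s" using B by (auto simp: B2_def)
    then have p: "p \<in> ends s" "p \<in> ends t" using meet_ends[of s t] sA t by blast+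
    have "p \<noteq> ?a" using unreach[OF t(1) p(2)] by auto
    then show "p \<in> {?b}" using p by (auto simp: ends_def)
  qed
  have sing: "connected S" if "S \<subseteq> {p}" for S and p :: complex
    using that by (auto dest: subset_singletonD)
  have sub_G: "G B1 \<subseteq> G (B - {s})" "G B2 \<subseteq> G (B - {s})" using B12 by (auto simp: G_def)
  txt \<open>Glue \<open>s\<close> to \<open>B1\<close>, then both to \<open>B2\<close>; each time the common part is at most one point.\<close>
  have "connected (- seg s)"
    using arc_A[OF sA] by (intro connected_arc_complement) auto
  then have ccs: "connected_component (- seg s) x y"
    using xy by (metis ComplI connected_iff_connected_component)
  have cc1: "connected_component (- (seg s \<union> G B1)) x y"
  proof (rule Janiszewski[OF _ _ _ ccs])
    show "compact (seg s)" using arc_A[OF sA] by (simp add: compact_arc_image)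
    show "closed (G B1)" using closed_G sub by simp
    show "connected (seg s \<inter> G B1)" using e1 sing by blast
    show "connected_component (- G B1) x y"
      using xy(1) sub_G by (meson Compl_anti_mono connected_component_of_subset)
  qed
  have "connected_component (- ((seg s \<union> G B1) \<union> G B2)) x y"
  proof (rule Janiszewski[OF _ _ _ cc1])
    show "compact (seg s \<union> G B1)" using arc_A[OF sA] compact_G sub by (simp add: compact_arc_image compact_Un)
    show "closed (G B2)" using closed_G sub by simp
    have "(seg s \<union> G B1) \<inter> G B2 \<subseteq> {?b}" using e2 disj by auto
    then show "connected ((seg s \<union> G B1) \<inter> G B2)" by (rule sing)
    show "connected_component (- G B2) x y"
      using xy(1) sub_G by (meson Compl_anti_mono connected_component_of_subset)
  qed
  moreover have "seg s \<union> G B1 \<union> G B2 = G B" using G_insert[OF B(2)] B12 by (auto simp: G_def)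
  ultimately show ?thesis by simp
qed

text \<open>The hypothesis \<open>u \<noteq> v\<close> forces at least one edge:
  \<open>link B u u\<close> holds even for points off \<open>G B\<close>, where no path within
  \<open>G B\<close> can start.\<close>

lemma link_path:
  assumes "link B u v" "u \<noteq> v" "B \<subseteq> A"
  shows "\<exists>g. path g \<and> path_image g \<subseteq> G B \<and> pathstart g = u \<and> pathfinish g = v"
  using assms(1,2)
proof (induction rule: link_induct)
  case (step y z s)
  then have s: "s \<in> B" "ends s = {y, z}" by auto
  have "path (c s)" using arc_A s assms(3) arc_imp_path by blast
  then have h: "\<exists>h. path h \<and> path_image h \<subseteq> G B \<and> pathstart h = y \<and> pathfinish h = z"
    using s by (intro exI[of _ "if pathstart (c s) = y then c s else reversepath (c s)"])
      (auto simp: ends_def G_def doubleton_eq_iff)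
  show ?case
  proof (cases "u = y")
    case True then show ?thesis using h by simp
  next
    case False
    then obtain g where "path g" "path_image g \<subseteq> G B" "pathstart g = u" "pathfinish g = y"
      using step by auto
    with h obtain h where "path h" "path_image h \<subseteq> G B" "pathstart h = y" "pathfinish h = z" by auto
    then show ?thesis using \<open>path g\<close> \<open>path_image g \<subseteq> G B\<close> \<open>pathstart g = u\<close> \<open>pathfinish g = y\<close>
      by (intro exI[of _ "g +++ h"]) (auto simp: path_image_join)
  qed
qed simp

text \<open>A detour around \<open>s\<close> within \<open>G (B - {s})\<close> contains an arc,
  which closes up with \<open>s\<close> to a Jordan curve \<open>C\<close>. That arc is all that
  \<open>C\<close> has in common with \<open>G (B - {s})\<close>, and so the intersection is
  connected, ready for Janiszewski's theorem.\<close>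

lemma cycle_through:
  assumes B: "B \<subseteq> A" "s \<in> B" "\<not> bridge B s"
  obtains C where "seg s \<subseteq> C" "C \<union> G (B - {s}) = G B" "connected (C \<inter> G (B - {s}))" "compact C"
    "connected (inside C)" "connected (outside C)" "inside C \<union> outside C = - C"
    "frontier (inside C) = C" "frontier (outside C) = C" "inside C \<inter> outside C = {}"
proof -
  let ?a = "pathstart (c s)" and ?b = "pathfinish (c s)"
  have sA: "s \<in> A" using B by auto
  have "link (B - {s}) ?a ?b" using B(3) by (simp add: bridge_def)
  from link_path[OF this ends_distinct[OF sA]] B(1)
  obtain g0 where g0: "path g0" "path_image g0 \<subseteq> G (B - {s})" "pathstart g0 = ?a" "pathfinish g0 = ?b"
    by auto
  obtain g where g: "arc g" "path_image g \<subseteq> G (B - {s})" "pathstart g = ?a" "pathfinish g = ?b"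
    using path_contains_arc[OF g0(1,3,4) ends_distinct[OF sA]] g0(2) by (metis order_trans)
  have int: "seg s \<inter> G (B - {s}) \<subseteq> ends s"
    using meet_ends[OF sA] B(1) by (fastforce simp: G_def)
  define h where "h = g +++ reversepath (c s)"
  have arcs: "arc (c s)" using arc_A sA by blast
  have sp: "simple_path h" unfolding h_def
    using g arcs int by (intro simple_path_join_loop) (auto simp: ends_def arc_reversepath)
  have loop: "pathfinish h = pathstart h" using g by (simp add: h_def)
  have im: "path_image h = path_image g \<union> seg s"
    using g by (simp add: h_def path_image_join)
  have "ends s \<subseteq> path_image g" using g by (metis ends_def insert_subset empty_subsetI pathstart_in_path_image pathfinish_in_path_image)
  then have "path_image h \<inter> G (B - {s}) = path_image g" using int g(2) im by blast
  then have co: "connected (path_image h \<inter> G (B - {s}))" using g(1) by (simp add: connected_arc_image)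
  have "compact (path_image h)" using sp by (rule compact_simple_path_image)
  then show thesis
    using Jordan_inside_outside[OF sp loop] im G_insert[OF B(2)] g(2) co
    by (intro that[of "path_image h"]) auto
qed


subsection \<open>Faces and the edges on their boundary\<close>

lemma face_props:
  assumes "B \<subseteq> A" "f \<in> faces B"
  shows "open f" "connected f" "f \<noteq> {}" "f \<inter> G B = {}" "frontier f \<subseteq> G B"
proof -
  have o: "open (- G B)" using closed_G assms by (simp add: open_Compl)
  show "open f" "connected f" "f \<noteq> {}" "f \<inter> G B = {}"
    using assms open_components[OF o] in_components_connected in_components_nonempty in_components_subset
    unfolding faces_def by blast+
  show "frontier f \<subseteq> G B"
    using frontier_of_components_closed_complement[OF closed_G] assms unfolding faces_def by blast
qed

lemma face_exists: "x \<notin> G B \<Longrightarrow> \<exists>f\<in>faces B. x \<in> f"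
  unfolding faces_def using Union_components[of "- G B"] by blast

lemma same_face:
  assumes "connected_component (- G B) x y" "f \<in> faces B" "f' \<in> faces B" "x \<in> f" "y \<in> f'"
  shows "f = f'"
proof -
  obtain T where T: "connected T" "T \<subseteq> - G B" "x \<in> T" "y \<in> T"
    using assms(1) by (auto simp: connected_component_def)
  have "T \<subseteq> f"
    using components_maximal[of f "- G B" T] T assms by (auto simp: faces_def)
  then show ?thesis
    using components_eq[of f "- G B" f'] T assms by (auto simp: faces_def)
qed

lemma connected_face_oseg:
  assumes "B \<subseteq> A" "s \<in> A" "f \<in> inc B s"
  shows "connected (f \<union> oseg s)"
proof -
  obtain p where p: "p \<in> closure f" "p \<in> oseg s" and f: "f \<in> faces B"
    using assms by (auto simp: inc_def)
  have "connected (insert p f)"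
    by (rule connected_intermediate_closure[OF face_props(2)[OF assms(1) f]])
      (use p closure_subset in auto)
  then have "connected (insert p f \<union> oseg s)"
    using connected_oseg[OF assms(2)] p by (intro connected_Un) auto
  then show ?thesis using p by (simp add: insert_absorb)
qed

text \<open>Once \<open>s\<close> is deleted, its open arc is a passage between all faces along it.
  \<open>f1\<close> and \<open>f2\<close> may coincide.\<close>

lemma across:
  assumes "B \<subseteq> A" "s \<in> B" "f1 \<in> inc B s" "f2 \<in> inc B s" "x1 \<in> f1" "x2 \<in> f2"
  shows "connected_component (- G (B - {s})) x1 x2"
proof -
  have s: "s \<in> A" using assms by auto
  have "connected ((f1 \<union> oseg s) \<union> (f2 \<union> oseg s))"
  proof (rule connected_Un)
    show "connected (f1 \<union> oseg s)" "connected (f2 \<union> oseg s)"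
      using connected_face_oseg[OF assms(1) s] assms by blast+
    show "(f1 \<union> oseg s) \<inter> (f2 \<union> oseg s) \<noteq> {}" using oseg_nonempty[OF s] by blast
  qed
  moreover have "f1 \<inter> G B = {}" "f2 \<inter> G B = {}"
    using assms face_props(4)[OF assms(1)] by (auto simp: inc_def)
  then have "(f1 \<union> oseg s) \<union> (f2 \<union> oseg s) \<subseteq> - G (B - {s})"
    using oseg_G_disjoint[OF s, of "B - {s}"] assms(1) G_insert[OF assms(2)] by blast
  ultimately show ?thesis using assms unfolding connected_component_def by blast
qed

text \<open>A face entering a small ball about \<open>p\<close> does not contain \<open>p\<close>,
  so it has a frontier point in the ball; there the graph consists of \<open>oseg s\<close> only. No
  local picture of two sides is required.\<close>

lemma oseg_nbhd:
  assumes "B \<subseteq> A" "s \<in> B" "p \<in> oseg s"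
  obtains e where "e > 0" "ball p e \<inter> G B \<subseteq> oseg s"
    "\<And>f. \<lbrakk>f \<in> faces B; f \<inter> ball p e \<noteq> {}\<rbrakk> \<Longrightarrow> f \<in> inc B s"
proof -
  have s: "s \<in> A" using assms by auto
  have "closed (G (B - {s}) \<union> ends s)"
    using assms(1) by (intro closed_Un closed_G finite_imp_closed) auto
  moreover have "p \<notin> G (B - {s}) \<union> ends s"
    using oseg_G_disjoint[OF s, of "B - {s}"] assms by (auto simp: oseg_def)
  ultimately obtain e where e: "e > 0" "ball p e \<subseteq> - (G (B - {s}) \<union> ends s)"
    by (metis ComplI open_Compl open_contains_ball)
  have sub: "ball p e \<inter> G B \<subseteq> oseg s"
    using e G_insert[OF assms(2)] seg_split[of s] by blast
  have "f \<in> inc B s" if f: "f \<in> faces B" "f \<inter> ball p e \<noteq> {}" for f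
  proof -
    note fp = face_props[OF assms(1) f(1)]
    have "p \<in> G B" using assms seg_split[of s] by (auto simp: G_def)
    then have "p \<in> ball p e - f" using fp(4) e(1) by auto
    then have "ball p e - f \<noteq> {}" by blast
    then have "ball p e \<inter> frontier f \<noteq> {}"
      using f(2) by (intro connected_Int_frontier) auto
    then show ?thesis using fp(5) sub f(1) frontier_def[of f] by (auto simp: inc_def)
  qed
  then show thesis using e sub that by blast
qed

text \<open>Deleting \<open>s\<close> merges the two faces through \<open>oseg s\<close>, and
  putting a bridge back does not part them.\<close>

lemma inc_bridge:
  assumes "B \<subseteq> A" "s \<in> B" "bridge B s" "f1 \<in> inc B s" "f2 \<in> inc B s"
  shows "f1 = f2"
proof -
  have f: "f1 \<in> faces B" "f2 \<in> faces B" using assms by (auto simp: inc_def)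
  obtain x1 x2 where x: "x1 \<in> f1" "x2 \<in> f2"
    using face_props(3)[OF assms(1)] f by blast
  have "x1 \<notin> G B" "x2 \<notin> G B" using face_props(4)[OF assms(1)] f x by blast+
  then have "x1 \<notin> seg s" "x2 \<notin> seg s" using G_insert[OF assms(2)] by auto
  then have "connected_component (- G B) x1 x2"
    using bridge_not_separating[OF assms(1-3)] across[OF assms(1,2,4,5) x] by blast
  then show ?thesis using same_face f x by blast
qed

text \<open>Faces along \<open>s\<close> on the same side of the Jordan curve \<open>C\<close> are
  connected both off \<open>C\<close> and, across \<open>s\<close>, off \<open>G (B - {s})\<close>;
  Janiszewski's theorem makes them equal. Both sides of \<open>C\<close> accumulate at every point
  of \<open>s\<close>, so each side contributes a face.\<close>

lemma inc_cycle:
  assumes "B \<subseteq> A" "s \<in> B" "\<not> bridge B s"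
  obtains f1 f2 where "f1 \<noteq> f2" "inc B s = {f1, f2}"
proof -
  have s: "s \<in> A" using assms by auto
  obtain C where C: "seg s \<subseteq> C" "C \<union> G (B - {s}) = G B" "connected (C \<inter> G (B - {s}))" "compact C"
    "connected (inside C)" "connected (outside C)" "inside C \<union> outside C = - C"
    "frontier (inside C) = C" "frontier (outside C) = C" "inside C \<inter> outside C = {}"
    using cycle_through[OF assms] .
  have uniq: "f1 = f2" if f: "f1 \<in> inc B s" "f2 \<in> inc B s" and x: "x1 \<in> f1" "x2 \<in> f2"
    and D: "connected D" "D \<subseteq> - C" "x1 \<in> D" "x2 \<in> D" for f1 f2 x1 x2 D
  proof -
    have "connected_component (- (C \<union> G (B - {s}))) x1 x2"
    proof (rule Janiszewski)
      show "compact C" "connected (C \<inter> G (B - {s}))" by fact+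
      show "closed (G (B - {s}))" using assms by (intro closed_G) auto
      show "connected_component (- C) x1 x2" using D by (auto simp: connected_component_def)
      show "connected_component (- G (B - {s})) x1 x2" using across[OF assms(1,2) f x] .
    qed
    then show ?thesis using C(2) f x same_face by (auto simp: inc_def)
  qed
  obtain p where p: "p \<in> oseg s" using oseg_nonempty[OF s] by blast
  then have pC: "p \<in> C" using C(1) seg_split[of s] by blast
  obtain e where e: "e > 0" "ball p e \<inter> G B \<subseteq> oseg s"
    "\<And>f. \<lbrakk>f \<in> faces B; f \<inter> ball p e \<noteq> {}\<rbrakk> \<Longrightarrow> f \<in> inc B s"
    by (rule oseg_nbhd[OF assms(1,2) p]) iprover
  have ex: "\<exists>f q. f \<in> inc B s \<and> q \<in> f \<and> q \<in> D" if D: "D \<inter> C = {}" "frontier D = C" for D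
  proof -
    have "p \<in> closure D" using pC D by (auto simp: frontier_def)
    then obtain q where q: "q \<in> D" "q \<in> ball p e"
      using e(1) by (metis closure_approachable mem_ball dist_commute)
    have "oseg s \<subseteq> C" using C(1) seg_split by blast
    then have "q \<notin> G B" using q D e(2) by blast
    then obtain f where "f \<in> faces B" "q \<in> f" using face_exists by blast
    then show ?thesis using e(3)[of f] q by blast
  qed
  have dis: "inside C \<inter> C = {}" "outside C \<inter> C = {}" using C(7) by auto
  obtain f1 q1 where 1: "f1 \<in> inc B s" "q1 \<in> f1" "q1 \<in> inside C"
    using ex[OF dis(1) C(8)] by blast
  obtain f2 q2 where 2: "f2 \<in> inc B s" "q2 \<in> f2" "q2 \<in> outside C"
    using ex[OF dis(2) C(9)] by blast
  have "f1 \<noteq> f2"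
  proof
    assume "f1 = f2"
    then have f: "f1 \<in> faces B" "q2 \<in> f1" using 1 2 by (auto simp: inc_def)
    note fp = face_props[OF assms(1) f(1)]
    have "f1 \<inter> frontier (inside C) \<noteq> {}"
    proof (rule connected_Int_frontier[OF fp(2)])
      show "f1 \<inter> inside C \<noteq> {}" "f1 - inside C \<noteq> {}" using 1 2 f(2) C(10) by blast+
    qed
    then show False using C(2,8) fp(4) by blast
  qed
  moreover have "f = f1 \<or> f = f2" if "f \<in> inc B s" for f
  proof -
    have f: "f \<in> faces B" using that by (simp add: inc_def)
    obtain x where x: "x \<in> f" using face_props(3)[OF assms(1) f] by blast
    have "x \<notin> C" using x face_props(4)[OF assms(1) f] C(2) by blast
    then consider "x \<in> inside C" | "x \<in> outside C" using C(7) by blast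
    then show ?thesis
    proof cases
      case 1
      then show ?thesis using uniq[OF that \<open>f1 \<in> inc B s\<close> x \<open>q1 \<in> f1\<close> C(5)] C(7) \<open>q1 \<in> inside C\<close> by blast
    next
      case 2
      then show ?thesis using uniq[OF that \<open>f2 \<in> inc B s\<close> x \<open>q2 \<in> f2\<close> C(6)] C(7) \<open>q2 \<in> outside C\<close> by blast
    qed
  qed
  ultimately show thesis using 1 2 that[of f1 f2] by blast
qed

lemma inc_card:
  assumes "B \<subseteq> A" "s \<in> B"
  shows "finite (inc B s)" "card (inc B s) \<le> 2"
proof -
  have "\<exists>f1 f2. inc B s \<subseteq> {f1, f2}"
  proof (cases "bridge B s")
    case True
    show ?thesis
    proof (cases "inc B s = {}")
      case False
      then obtain f where "f \<in> inc B s" by blast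
      then show ?thesis using inc_bridge[OF assms True] by blast
    qed auto
  next
    case False
    then show ?thesis using inc_cycle[OF assms] by (metis order_refl)
  qed
  then obtain f1 f2 where f: "inc B s \<subseteq> {f1, f2}" by blast
  then show "finite (inc B s)" by (rule finite_subset) simp
  have "card (inc B s) \<le> card {f1, f2}" using f by (intro card_mono) auto
  also have "\<dots> \<le> 2" by (simp add: card_insert_if)
  finally show "card (inc B s) \<le> 2" .
qed

text \<open>A connected set can leave a face only through its frontier, and a frontier point off the
  nodes lies on an open edge in \<open>bdry B f\<close>. This takes the place of tracing the
  boundary.\<close>

lemma face_absorb:
  assumes "B \<subseteq> A" "f \<in> faces B" "connected U" "U \<inter> f \<noteq> {}" "U \<inter> nodes B = {}"
    "\<And>s. s \<in> bdry B f \<Longrightarrow> U \<inter> oseg s = {}"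
  shows "U \<subseteq> f"
proof (rule ccontr)
  assume "\<not> U \<subseteq> f"
  then have "U \<inter> frontier f \<noteq> {}"
    using assms(3,4) by (intro connected_Int_frontier) auto
  then obtain p where p: "p \<in> U" "p \<in> frontier f" by blast
  then have "p \<in> G B" "p \<in> closure f"
    using face_props(5)[OF assms(1,2)] by (auto simp: frontier_def)
  then obtain s where "s \<in> B" "p \<in> oseg s" using p assms(5) G_split[of B] by blast
  then have "s \<in> bdry B f" using \<open>p \<in> closure f\<close> by (auto simp: bdry_def)
  then show False using assms(6) p \<open>p \<in> oseg s\<close> by blast
qed

lemma connected_minus_nodes:
  fixes U :: "complex set"
  assumes "B \<subseteq> A" "open U" "connected U"
  shows "connected (U - nodes B)"
  using assms finite_nodes by (intro connected_open_delete_finite) auto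

text \<open>A face without border edges would absorb the plane minus finitely many nodes, open edges
  included.\<close>

lemma bdry_nonempty:
  assumes "B \<subseteq> A" "B \<noteq> {}" "f \<in> faces B"
  shows "bdry B f \<noteq> {}"
proof
  assume *: "bdry B f = {}"
  note fp = face_props[OF assms(1,3)]
  have "UNIV - nodes B \<subseteq> f"
  proof (rule face_absorb[OF assms(1,3)])
    show "connected (UNIV - nodes B)" using connected_minus_nodes[OF assms(1)] by auto
    show "(UNIV - nodes B) \<inter> f \<noteq> {}" using fp nodes_subset_G[of B] by blast
  qed (use * in auto)
  moreover obtain s where s: "s \<in> B" using assms by blast
  then have sA: "s \<in> A" using assms(1) by blast
  have "oseg s \<noteq> {}" "oseg s \<inter> nodes B = {}"
    using oseg_nonempty[OF sA] oseg_nodes_disjoint[OF sA assms(1)] .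
  moreover have "oseg s \<subseteq> G B" using s seg_split by (auto simp: G_def)
  ultimately show False using fp(4) by blast
qed

lemma finite_faces:
  assumes "B \<subseteq> A" shows "finite (faces B)"
proof (cases "B = {}")
  case True
  have "components (UNIV :: complex set) \<subseteq> {UNIV}"
    using connected_component_eq_self[of "UNIV :: complex set"] by (auto simp: components_def)
  then show ?thesis using True by (auto simp: faces_def G_def intro: finite_subset)
next
  case False
  have "faces B \<subseteq> (\<Union>s\<in>B. inc B s)"
    using bdry_nonempty[OF assms False] by (fastforce simp: bdry_def inc_def)
  then show ?thesis
    by (rule finite_subset) (use inc_card(1)[OF assms] finite_subset[OF assms finite_A] in auto)
qed

lemma faces_nonempty: assumes "B \<subseteq> A" shows "faces B \<noteq> {}"
proof -
  have "G B \<noteq> UNIV" using compact_G[OF assms] by (metis compact_imp_bounded not_bounded_UNIV)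
  then show ?thesis using face_exists by blast
qed

text \<open>Stands in for the fact that an edge traversed once by a facial walk lies on a cycle of
  that walk. It says more than that \<open>s\<close> is no bridge of \<open>B\<close>: the detour
  between the ends of \<open>s\<close> stays on the boundary of \<open>f\<close>.\<close>

lemma bdry_not_bridge:
  assumes "B \<subseteq> A" "s \<in> bdry B f" "f \<in> faces B" "f' \<in> inc B s" "f' \<noteq> f"
  shows "\<not> bridge (bdry B f) s"
proof
  assume br: "bridge (bdry B f) s"
  txt \<open>Otherwise \<open>f\<close> and \<open>f'\<close> lie in one component of the complement of the boundary graph, but inside
    that component \<open>f\<close> has no frontier except nodes.\<close>
  define S where "S = bdry B f"
  have S: "S \<subseteq> B" "S \<subseteq> A" "s \<in> S" "s \<in> B" using assms by (auto simp: S_def bdry_def)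
  have f: "f \<in> inc B s" "f' \<in> faces B" using assms by (auto simp: bdry_def inc_def)
  obtain x y where xy: "x \<in> f" "y \<in> f'" using face_props(3)[OF assms(1)] f assms by blast
  have nG: "x \<notin> G B" "y \<notin> G B" using face_props(4)[OF assms(1)] f assms(3) xy by blast+
  have "connected_component (- G (B - {s})) x y"
    using across[OF assms(1) S(4) f(1) assms(4) xy] .
  moreover have "- G (B - {s}) \<subseteq> - G (S - {s})" using S by (auto simp: G_def)
  ultimately have "connected_component (- G (S - {s})) x y"
    by (metis connected_component_of_subset)
  moreover have "x \<notin> seg s" "y \<notin> seg s" using nG G_insert[OF S(4)] by auto
  ultimately have "connected_component (- G S) x y"
    using bridge_not_separating[OF S(2,3)] br by (simp add: S_def)
  then have "y \<in> connected_component_set (- G S) x" by simp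
  moreover define W where "W = connected_component_set (- G S) x"
  ultimately have y: "y \<in> W" by simp
  have x: "x \<in> W" unfolding W_def using nG S(1) by (auto simp: G_def)
  have W: "open W" "connected W" "W \<subseteq> - G S"
    unfolding W_def using closed_G[OF S(2)]
    by (auto intro: open_connected_component open_Compl dest: connected_component_in)
  have nn: "x \<notin> nodes B" "y \<notin> nodes B" using nG nodes_subset_G by blast+
  have "W - nodes B \<subseteq> f"
  proof (rule face_absorb[OF assms(1,3)])
    show "connected (W - nodes B)" using connected_minus_nodes[OF assms(1) W(1,2)] .
    show "(W - nodes B) \<inter> f \<noteq> {}" using x xy nn by blast
    show "(W - nodes B) \<inter> oseg t = {}" if "t \<in> bdry B f" for t
      using that W(3) seg_split[of t] by (auto simp: G_def S_def)
  qed auto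
  then have "y \<in> f" using y nn by blast
  then show False
    using xy assms f components_eq[of f "- G B" f'] by (auto simp: faces_def)
qed

text \<open>Treats a face that lies on both sides of all its border edges, such as the face of a
  tree. Nothing lies beyond such edges, so there is no room for further ones.\<close>

lemma bdry_all:
  assumes "B \<subseteq> A" "f \<in> faces B" and single: "\<And>s. s \<in> bdry B f \<Longrightarrow> inc B s \<subseteq> {f}"
  shows "bdry B f = B"
proof -
  note fp = face_props[OF assms(1,2)]
  define S where "S = bdry B f"
  have S: "S \<subseteq> B" by (auto simp: S_def bdry_def)
  txt \<open>This set is open and closed in the plane minus the nodes, hence all of it.\<close>
  define W where "W = f \<union> (\<Union>s\<in>S. oseg s)"
  have "\<exists>e>0. ball p e \<subseteq> W" if p: "p \<in> W" for p
  proof (cases "p \<in> f")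
    case True
    then obtain e where "e > 0" "ball p e \<subseteq> f" using fp(1) open_contains_ball by metis
    then show ?thesis unfolding W_def by blast
  next
    case False
    then obtain s where s: "s \<in> S" "p \<in> oseg s" using p by (auto simp: W_def)
    obtain e where e: "e > 0" "ball p e \<inter> G B \<subseteq> oseg s"
      "\<And>f. \<lbrakk>f \<in> faces B; f \<inter> ball p e \<noteq> {}\<rbrakk> \<Longrightarrow> f \<in> inc B s"
      by (rule oseg_nbhd[OF assms(1) subsetD[OF S s(1)] s(2)]) iprover
    have "q \<in> W" if q: "q \<in> ball p e" for q
    proof (cases "q \<in> G B")
      case True
      then show ?thesis using e(2) q s by (auto simp: W_def)
    next
      case False
      then obtain f' where f': "f' \<in> faces B" "q \<in> f'" using face_exists by blast
      then have "f' \<in> inc B s" using e(3) q by blast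
      then have "f' = f" using single s(1) by (auto simp: S_def)
      then show ?thesis using f' by (simp add: W_def)
    qed
    then show ?thesis using e(1) by blast
  qed
  then have oW: "open W" by (simp add: open_contains_ball)
  have clW: "closure W \<subseteq> W \<union> nodes B"
  proof -
    have fS: "finite S" by (rule finite_subset[OF _ finite_A]) (use S assms(1) in blast)
    have "closed (closure f \<union> (\<Union>s\<in>S. seg s))"
      using fS S assms(1) arc_A by (intro closed_Un closed_UN) (auto intro!: closed_arc_image)
    then have "closure W \<subseteq> closure f \<union> (\<Union>s\<in>S. seg s)"
      using closure_subset[of f] seg_split by (intro closure_minimal) (auto simp: W_def)
    also have "\<dots> \<subseteq> closure f \<union> (\<Union>s\<in>S. oseg s \<union> ends s)"
      using seg_split by blast
    also have "\<dots> \<subseteq> W \<union> nodes B"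
    proof -
      have "closure f \<subseteq> W \<union> nodes B"
      proof
        fix p assume p: "p \<in> closure f"
        show "p \<in> W \<union> nodes B"
        proof (cases "p \<in> f")
          case False
          then have "p \<in> G B" using p fp(1,5) by (auto simp: frontier_def interior_open)
          then show ?thesis using p G_split[of B] by (auto simp: W_def S_def bdry_def)
        qed (simp add: W_def)
      qed
      then show ?thesis using S by (auto simp: W_def nodes_def)
    qed
    finally show ?thesis .
  qed
  have "UNIV - nodes B \<subseteq> W"
  proof (rule ccontr)
    assume "\<not> UNIV - nodes B \<subseteq> W"
    moreover have "connected (UNIV - nodes B)" using connected_minus_nodes[OF assms(1)] by auto
    moreover have "(UNIV - nodes B) \<inter> W \<noteq> {}" using fp(3,4) nodes_subset_G[of B] unfolding W_def by blast
    ultimately have "(UNIV - nodes B) \<inter> frontier W \<noteq> {}"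
      by (intro connected_Int_frontier) auto
    then show False using clW oW by (auto simp: frontier_def interior_open)
  qed
  have "t \<in> S" if t: "t \<in> B" for t
  proof -
    have tA: "t \<in> A" using t assms by auto
    obtain p where p: "p \<in> oseg t" using oseg_nonempty[OF tA] by blast
    then have "p \<in> W" using oseg_nodes_disjoint[OF tA assms(1)] \<open>UNIV - nodes B \<subseteq> W\<close> by blast
    moreover have "p \<in> G B" using p t seg_split by (auto simp: G_def)
    ultimately obtain s where s: "s \<in> S" "p \<in> oseg s" using fp(4) by (auto simp: W_def)
    then have "s = t" using oseg_seg_disjoint[of s t] p tA S assms(1) seg_split[of t] by blast
    then show ?thesis using s by simp
  qed
  then show ?thesis using S by (auto simp: S_def)
qed


subsection \<open>Euler's inequality\<close>

lemma nodes_mono: "S \<subseteq> B \<Longrightarrow> nodes S \<subseteq> nodes B"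
  by (auto simp: nodes_def)

text \<open>Each face of \<open>B\<close> lies in one component of the larger complement. The
  resulting map is onto and identifies the two faces along \<open>s\<close>, so it stays onto
  without \<open>f2\<close>.\<close>

lemma card_faces_remove:
  assumes "B \<subseteq> A" "s \<in> B" "\<not> bridge B s"
  shows "card (faces (B - {s})) < card (faces B)"
proof -
  have B': "B - {s} \<subseteq> A" using assms by auto
  obtain f1 f2 where f12: "f1 \<noteq> f2" "inc B s = {f1, f2}" using inc_cycle[OF assms] .
  then have f: "f1 \<in> inc B s" "f2 \<in> inc B s" "f1 \<in> faces B" "f2 \<in> faces B" by (auto simp: inc_def)
  obtain C where C: "seg s \<subseteq> C" "frontier (inside C) = C" "inside C \<union> outside C = - C"
    by (rule cycle_through[OF assms]) iprover
  \<comment> \<open>The chosen point does not matter: a face is connected and avoids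
    \<open>G (B - {s})\<close>.\<close>
  define \<phi> where "\<phi> h = connected_component_set (- G (B - {s})) (SOME x. x \<in> h)" for h
  have phi: "\<phi> h = connected_component_set (- G (B - {s})) x" if h: "h \<in> faces B" "x \<in> h" for h x
  proof -
    have "(SOME x. x \<in> h) \<in> h" using h(2) by (rule someI)
    moreover have "h \<subseteq> - G (B - {s})" using face_props(4)[OF assms(1) h(1)] G_insert[OF assms(2)] by blast
    ultimately have "connected_component (- G (B - {s})) (SOME x. x \<in> h) x"
      using face_props(2)[OF assms(1) h(1)] h(2) by (auto simp: connected_component_def)
    then show ?thesis unfolding \<phi>_def by (rule connected_component_eq[symmetric, OF iffD2[OF mem_Collect_eq]])
  qed
  obtain x1 x2 where x: "x1 \<in> f1" "x2 \<in> f2" using face_props(3)[OF assms(1)] f by blast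
  have "connected_component (- G (B - {s})) x1 x2" using across[OF assms(1,2) f(1,2) x] .
  then have phi_eq: "\<phi> f1 = \<phi> f2"
    using phi f x connected_component_eq[of x2 "- G (B - {s})" x1] by simp
  have "faces (B - {s}) \<subseteq> \<phi> ` (faces B - {f2})"
  proof
    fix g assume g: "g \<in> faces (B - {s})"
    note gp = face_props[OF B' g]
    \<comment> \<open>A face is open, but \<open>seg s\<close> has no interior: it lies on
      \<open>C\<close>, all of whose points are limits of \<open>inside C\<close>.\<close>
    have "\<not> g \<subseteq> seg s"
    proof
      assume gs: "g \<subseteq> seg s"
      obtain p where p: "p \<in> g" using gp(3) by blast
      then have "p \<in> closure (inside C)" using gs C by (auto simp: frontier_def)
      then have "g \<inter> inside C \<noteq> {}" using p gp(1) open_Int_closure_eq_empty by blast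
      then show False using gs C inside_no_overlap[of C] by blast
    qed
    then obtain x where xg: "x \<in> g" "x \<notin> seg s" by blast
    then have "x \<notin> G B" using gp(4) G_insert[OF assms(2)] by blast
    then obtain h where h: "h \<in> faces B" "x \<in> h" using face_exists by blast
    have "g = connected_component_set (- G (B - {s})) x"
    proof -
      obtain z where z: "g = connected_component_set (- G (B - {s})) z"
        using g by (auto simp: faces_def components_def)
      then show ?thesis using connected_component_eq xg(1) by metis
    qed
    then have gh: "g = \<phi> h" using phi[OF h] by simp
    show "g \<in> \<phi> ` (faces B - {f2})"
    proof (cases "h = f2")
      case True
      then show ?thesis using gh phi_eq f f12(1) by (intro image_eqI[of _ _ f1]) auto
    qed (use gh h in auto)
  qed
  then have "card (faces (B - {s})) \<le> card (faces B - {f2})"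
    using finite_faces[OF assms(1)] by (intro surj_card_le) auto
  also have "\<dots> < card (faces B)"
    using finite_faces[OF assms(1)] f by (intro psubset_card_mono) auto
  finally show ?thesis .
qed

text \<open>A bridge \<open>s\<close> splits the nodes into those linked to its start and the rest,
  which contains its finish. The other edges split accordingly, and the two inductive bounds add up,
  with \<open>s\<close> as the missing edge. An arbitrary \<open>N\<close> above
  \<open>nodes B\<close> keeps parts without edges in the count.\<close>

lemma forest_card:
  assumes "B \<subseteq> A" "\<And>s. s \<in> B \<Longrightarrow> bridge B s" "finite N" "nodes B \<subseteq> N" "N \<noteq> {}"
  shows "card B + 1 \<le> card N"
  using assms
proof (induction "card B" arbitrary: B N rule: less_induct)
  case less
  have fB: "finite B" using less.prems(1) finite_A finite_subset by blast
  show ?case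
  proof (cases "B = {}")
    case True
    then show ?thesis using less.prems by (simp add: Suc_leI card_gt_0_iff)
  next
    case False
    then obtain s where s: "s \<in> B" by blast
    let ?a = "pathstart (c s)" and ?b = "pathfinish (c s)"
    define N1 where "N1 = {v \<in> N. link (B - {s}) ?a v}"
    define B1 where "B1 = {t \<in> B - {s}. pathstart (c t) \<in> N1}"
    have ends_N: "ends t \<subseteq> N" if "t \<in> B" for t using less.prems(4) that by (auto simp: nodes_def)
    have nB1: "nodes B1 \<subseteq> N1"
    proof -
      have "ends t \<subseteq> N1" if "t \<in> B1" for t
        using that ends_N[of t] link_step[of t "B - {s}"]
        by (auto simp: B1_def N1_def ends_def intro: link_trans)
      then show ?thesis by (auto simp: nodes_def)
    qed
    have nB2: "nodes (B - {s} - B1) \<subseteq> N - N1"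
    proof -
      have "ends t \<subseteq> N - N1" if "t \<in> B - {s} - B1" for t
        using that ends_N[of t] link_sym[OF link_step[of t "B - {s}"]]
        by (auto simp: B1_def N1_def ends_def intro: link_trans)
      then show ?thesis by (auto simp: nodes_def)
    qed
    have a: "?a \<in> N1" using ends_N[OF s] by (auto simp: N1_def ends_def)
    have b: "?b \<in> N - N1" using ends_N[OF s] less.prems(2)[OF s] by (auto simp: N1_def ends_def bridge_def)
    have br: "bridge S t" if "S \<subseteq> B" "t \<in> S" for S t
      using less.prems(2)[of t] that link_mono[of "S - {t}" _ _ "B - {t}"] unfolding bridge_def by blast
    have c1: "card B1 < card B" "card (B - {s} - B1) < card B"
      using s fB by (auto simp: B1_def intro!: psubset_card_mono)
    have "card B1 + 1 \<le> card N1"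
      using less.prems(1,3) a nB1 br by (intro less.hyps[OF c1(1)]) (auto simp: B1_def N1_def)
    moreover have "card (B - {s} - B1) + 1 \<le> card (N - N1)"
      using less.prems(1,3) b nB2 br[of "B - {s} - B1"] by (intro less.hyps[OF c1(2)]) auto
    moreover have "card (B - {s} - B1) = card B - 1 - card B1"
      using s fB by (subst card_Diff_subset) (auto simp: B1_def)
    moreover have "card B1 \<le> card B - 1"
      using card_mono[of "B - {s}" B1] s fB by (auto simp: B1_def)
    moreover have "card (N - N1) = card N - card N1" "card N1 \<le> card N"
      using less.prems(3) by (auto simp: N1_def card_Diff_subset card_mono)
    moreover have "card B \<ge> 1" using s fB card_gt_0_iff[of B] by auto
    ultimately show ?thesis by linarith
  qed
qed

text \<open>Deleting a non-bridge costs at least one face while \<open>N\<close> stays fixed; the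
  forest left in the end still has a face.\<close>

lemma euler_inequality:
  assumes "B \<subseteq> A" "finite N" "nodes B \<subseteq> N" "N \<noteq> {}"
  shows "card B + 2 \<le> card (faces B) + card N"
  using assms
proof (induction "card B" arbitrary: B)
  case 0
  then have "B = {}" using finite_A finite_subset by (metis card_eq_0_iff)
  then have "card (faces B) \<ge> 1"
    using finite_faces[of B] faces_nonempty[of B] by (simp add: Suc_leI card_gt_0_iff)
  moreover have "card N \<ge> 1" using 0 by (simp add: Suc_leI card_gt_0_iff)
  ultimately show ?case using \<open>B = {}\<close> by simp
next
  case (Suc n)
  have cf: "card (faces B) \<ge> 1"
    using finite_faces[of B] faces_nonempty[of B] Suc.prems by (simp add: Suc_leI card_gt_0_iff)
  show ?case
  proof (cases "\<forall>s\<in>B. bridge B s")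
    case True
    then show ?thesis using forest_card[of B N] Suc.prems cf by auto
  next
    case False
    then obtain s where s: "s \<in> B" "\<not> bridge B s" by blast
    have "card (B - {s}) = n" using Suc.hyps(2) s by simp
    then have "card (B - {s}) + 2 \<le> card (faces (B - {s})) + card N"
      using Suc.prems nodes_mono[of "B - {s}" B] by (intro Suc.hyps(1)) auto
    then show ?thesis
      using card_faces_remove[OF Suc.prems(1) s] \<open>card (B - {s}) = n\<close> Suc.hyps(2) by linarith
  qed
qed


subsection \<open>Discharging\<close>

text \<open>The way to refute a link: a set that no edge leaves traps everything reachable from
  inside it.\<close>

lemma link_closed:
  assumes "link B u v" "u \<in> K" "\<And>s. s \<in> B \<Longrightarrow> ends s \<subseteq> K \<or> ends s \<inter> K = {}"
  shows "v \<in> K"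
  using assms(1,2)
proof (induction rule: link_induct)
  case (step y z s)
  then show ?case using assms(3)[of s] by auto
qed

text \<open>If \<open>s\<close> and \<open>t\<close> were the whole border, \<open>f\<close> would
  fill, up to nodes, the component \<open>D\<close> of their complement around it. But a node in
  \<open>D\<close> is an end of some edge, whose open part then runs into \<open>D\<close> as
  well.\<close>

lemma bdry_two_ends_differ:
  assumes lens: "\<And>D. D \<in> components (- (seg s \<union> seg t)) \<Longrightarrow> D \<inter> nodes A \<noteq> {}"
    and f: "f \<in> faces A"
  shows "bdry A f \<noteq> {s, t}"
proof
  assume st: "bdry A f = {s, t}"
  note fp = face_props[OF order_refl f]
  have stA: "s \<in> A" "t \<in> A" using st by (auto simp: bdry_def)
  have sub: "seg s \<union> seg t \<subseteq> G A" using stA by (auto simp: G_def)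
  have cl: "closed (seg s \<union> seg t)" using arc_A stA by (simp add: closed_arc_image closed_Un)
  obtain D where D: "D \<in> components (- (seg s \<union> seg t))" "f \<subseteq> D"
    using exists_component_superset[of f "- (seg s \<union> seg t)"] fp sub by blast
  have oD: "open D" using open_components D cl by (metis open_Compl)
  have DC: "D \<inter> (seg s \<union> seg t) = {}" using in_components_subset[OF D(1)] by blast
  have "D - nodes A \<subseteq> f"
  proof (rule face_absorb[OF order_refl f])
    show "connected (D - nodes A)"
      using connected_minus_nodes[OF order_refl oD] in_components_connected[OF D(1)] .
    show "(D - nodes A) \<inter> f \<noteq> {}" using fp(3,4) D(2) nodes_subset_G by blast
    show "(D - nodes A) \<inter> oseg r = {}" if "r \<in> bdry A f" for r
      using that st DC by (auto simp: oseg_def)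
  qed auto
  moreover obtain p r where p: "p \<in> D" "r \<in> A" "p \<in> ends r"
    using lens[OF D(1)] by (auto simp: nodes_def)
  have "p \<in> closure (oseg r)" using closure_oseg[OF p(2)] p(3) ends_subset by blast
  then obtain q where "q \<in> D" "q \<in> oseg r"
    using p(1) oD open_Int_closure_eq_empty[of D "oseg r"] by blast
  moreover have "q \<notin> nodes A" "q \<in> G A"
    using \<open>q \<in> oseg r\<close> oseg_nodes_disjoint[OF p(2) order_refl] p(2) seg_split[of r] by (auto simp: G_def)
  ultimately show False using fp(4) by blast
qed

text \<open>The multiplicity with which an edge occurs on each face it borders: a bridge has the same face on
  both sides.\<close>

definition sides :: "'s \<Rightarrow> nat" where "sides s = (if card (inc A s) = 2 then 1 else 2)"

lemma sides_one_link:
  assumes "f \<in> faces A" "s \<in> bdry A f" "sides s = 1"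
  shows "link (bdry A f - {s}) (pathstart (c s)) (pathfinish (c s))"
proof -
  have "card (inc A s) = 2" using assms(3) by (auto simp: sides_def split: if_splits)
  then obtain f1 f2 where "inc A s = {f1, f2}" "f1 \<noteq> f2" by (auto simp: card_2_iff)
  then obtain f' where "f' \<in> inc A s" "f' \<noteq> f" by blast
  then show ?thesis
    using bdry_not_bridge[OF order_refl assms(2,1)] by (auto simp: bridge_def)
qed

text \<open>If every border edge counts twice, the border is all of \<open>A\<close>, and two edges
  already give 20. Otherwise there are at least three border edges: four give 20, and three fall
  short of 16 only if all are halves that count once.\<close>

lemma face_weight:
  assumes lens: "\<And>s t D. \<lbrakk>s \<in> A; t \<in> A; s \<noteq> t; ends s = ends t; D \<in> components (- (seg s \<union> seg t))\<rbrakk>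
      \<Longrightarrow> D \<inter> nodes A \<noteq> {}"
    and half: "\<And>s. s \<in> H \<Longrightarrow> \<exists>x v. ends s = {x, v} \<and> x \<in> X \<and> v \<notin> X"
    and no3: "\<And>s t u. \<lbrakk>s \<in> H; t \<in> H; u \<in> H; s \<noteq> t; s \<noteq> u; t \<noteq> u; ends s = ends t; ends u = ends s\<rbrakk> \<Longrightarrow> False"
    and two: "card A \<ge> 2" and f: "f \<in> faces A"
  shows "16 \<le> (\<Sum>s\<in>bdry A f. sides s * (if s \<in> H then 5 else 6))"
proof -
  define S where "S = bdry A f"
  let ?w = "\<lambda>s. sides s * (if s \<in> H then 5 else 6 :: nat)"
  have SA: "S \<subseteq> A" by (auto simp: S_def bdry_def)
  have fS: "finite S" using SA finite_A by (rule finite_subset)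
  have inc: "f \<in> inc A s" if "s \<in> S" for s using that f by (auto simp: S_def bdry_def inc_def)
  have w5: "5 \<le> ?w s" for s by (auto simp: sides_def)
  have w6: "6 \<le> ?w s" if "s \<notin> H \<or> sides s \<noteq> 1" for s using that by (auto simp: sides_def)
  have w10: "10 \<le> ?w s" if "sides s \<noteq> 1" for s using that by (auto simp: sides_def)
  have card5: "card T * 5 \<le> sum ?w T" for T using sum_mono[of T "\<lambda>_. 5" ?w] w5 by simp
  have "16 \<le> sum ?w S"
  proof (cases "\<forall>s\<in>S. sides s \<noteq> 1")
    case True
    have "inc A s \<subseteq> {f}" if s: "s \<in> S" for s
    proof -
      have "card (inc A s) \<le> 1" "finite (inc A s)"
        using inc_card[of A s] True s SA by (force simp: sides_def split: if_splits)+
      then show ?thesis using inc[OF s] by (auto simp: card_le_Suc0_iff_eq)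
    qed
    then have "S = A" using bdry_all[OF order_refl f] by (simp add: S_def)
    moreover have "card A * 10 \<le> sum ?w A"
      using sum_mono[of A "\<lambda>_. 10" ?w] w10 True \<open>S = A\<close> by simp
    ultimately show ?thesis using two by simp
  next
    case False
    then obtain s where s: "s \<in> S" "sides s = 1" by blast
    have nb: "link (S - {r}) (pathstart (c r)) (pathfinish (c r))" if "r \<in> S" "sides r = 1" for r
      using sides_one_link[OF f] that by (simp add: S_def)
    have nontriv: "r \<in> A \<Longrightarrow> pathfinish (c r) \<notin> {pathstart (c r)}" for r using ends_distinct[of r] by auto
    have S1: "S \<noteq> {s}"
      using link_closed[OF nb[OF s], of "{pathstart (c s)}"] nontriv[of s] s SA by auto
    \<comment> \<open>A lone companion \<open>t\<close> has to join the two ends of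
      \<open>s\<close>; then both are parallel and bound a lens.\<close>
    have S2: "S \<noteq> {s, t}" if "t \<noteq> s" for t
    proof
      assume St: "S = {s, t}"
      then have S': "S - {s} = {t}" using that by auto
      have stA: "s \<in> A" "t \<in> A" using St SA by auto
      have l: "link {t} (pathstart (c s)) (pathfinish (c s))" using nb[OF s] S' by simp
      have "pathstart (c s) \<in> ends t"
      proof (rule ccontr)
        assume "pathstart (c s) \<notin> ends t"
        then show False using link_closed[OF l, of "{pathstart (c s)}"] nontriv[OF stA(1)] by auto
      qed
      moreover have "pathfinish (c s) \<in> ends t" using link_closed[OF l, of "ends t"] calculation by auto
      ultimately have "ends s = ends t" using ends_distinct[OF stA(1)] by (auto simp: ends_def)
      then show False
        using bdry_two_ends_differ[OF lens[OF stA that[symmetric]] f] St by (simp add: S_def)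
    qed
    have "card S \<noteq> 0" "card S \<noteq> 1" "card S \<noteq> 2"
      using s fS S1 S2 by (auto simp: card_1_singleton_iff card_2_iff)
    then consider "card S \<ge> 4" | "card S = 3" by linarith
    then show ?thesis
    proof cases
      case 1
      then show ?thesis using card5[of S] by linarith
    next
      case 2
      show ?thesis
      proof (cases "\<exists>t\<in>S. t \<notin> H \<or> sides t \<noteq> 1")
        case True
        then obtain t where t: "t \<in> S" "6 \<le> ?w t" using w6 by blast
        have "sum ?w S = ?w t + sum ?w (S - {t})" using fS t(1) by (rule sum.remove)
        moreover have "card (S - {t}) = 2" using 2 t by simp
        ultimately show ?thesis using card5[of "S - {t}"] t(2) by linarith
      next
        case False
        then have all: "\<And>r. r \<in> S \<Longrightarrow> r \<in> H \<and> sides r = 1" by blast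
        \<comment> \<open>The detour from \<open>x\<close> to \<open>v\<close> has only the two
          other halves at its disposal. Halves alternate between \<open>X\<close> and its
          complement, so a detour of length two is impossible and a single half joins
          \<open>x\<close> to \<open>v\<close>.\<close>
        have par: "\<exists>t\<in>S - {r}. ends t = ends r" if r: "r \<in> S" for r
        proof -
          obtain x v where xv: "ends r = {x, v}" "x \<in> X" "v \<notin> X" using half all r by blast
          have l: "link (S - {r}) x v"
            using nb[OF r] link_sym[OF nb[OF r]] all r xv(1) by (auto simp: ends_def doubleton_eq_iff)
          have "x \<noteq> v" using xv by auto
          obtain t where t: "t \<in> S - {r}" "x \<in> ends t"
            using link_closed[OF l, of "{x}"] \<open>x \<noteq> v\<close> by blast
          obtain u where u: "u \<in> S - {r}" "v \<in> ends u"
            using link_closed[OF link_sym[OF l], of "{v}"] \<open>x \<noteq> v\<close> by blast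
          obtain x' v' where t': "ends t = {x', v'}" "x' \<in> X" "v' \<notin> X" using half all t by blast
          obtain x'' v'' where u': "ends u = {x'', v''}" "x'' \<in> X" "v'' \<notin> X" using half all u by blast
          have e: "x' = x" "v'' = v" using t u t' u' xv by auto
          show ?thesis
          proof (rule ccontr)
            assume no: "\<not> ?thesis"
            then have ne: "v' \<noteq> v" "x'' \<noteq> x" "t \<noteq> u" using t u t' u' xv e by auto
            have "card (S - {r}) = 2" using 2 r by simp
            then have "{t, u} = S - {r}"
              using t(1) u(1) ne(3) fS by (intro card_subset_eq) auto
            moreover have "ends u \<inter> ends t = {}" using t' u' e ne by auto
            ultimately have "ends w \<subseteq> ends t \<or> ends w \<inter> ends t = {}" if "w \<in> S - {r}" for w
              using that by (metis insertE order_refl singletonD)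
            then have "v \<in> ends t" by (rule link_closed[OF l t(2)])
            then show False using t' xv ne by auto
          qed
        qed
        obtain t where t: "t \<in> S" "t \<noteq> s" "ends t = ends s" using par[OF s(1)] by blast
        have "card (S - {s, t}) = 1" using 2 s t fS by (simp add: card_Diff_subset)
        then obtain u where u: "S - {s, t} = {u}" by (auto simp: card_1_singleton_iff)
        then have "u \<in> S" "u \<noteq> s" "u \<noteq> t" by auto
        moreover have "ends u = ends s" using par[OF \<open>u \<in> S\<close>] u t by blast
        ultimately show ?thesis using no3[of s t u] all s t by metis
      qed
    qed
  qed
  then show ?thesis by (simp add: S_def)
qed

text \<open>Exchanging the sums over faces and edges turns \<open>face_weight\<close> into an upper
  bound on the number of faces, which Euler's inequality bounds from below.\<close>

lemma weighted_edge_bound: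
  assumes lens: "\<And>s t D. \<lbrakk>s \<in> A; t \<in> A; s \<noteq> t; ends s = ends t; D \<in> components (- (seg s \<union> seg t))\<rbrakk>
      \<Longrightarrow> D \<inter> nodes A \<noteq> {}"
    and half: "\<And>s. s \<in> H \<Longrightarrow> \<exists>x v. ends s = {x, v} \<and> x \<in> X \<and> v \<notin> X"
    and no3: "\<And>s t u. \<lbrakk>s \<in> H; t \<in> H; u \<in> H; s \<noteq> t; s \<noteq> u; t \<noteq> u; ends s = ends t; ends u = ends s\<rbrakk> \<Longrightarrow> False"
    and two: "card A \<ge> 2" and H: "H \<subseteq> A"
    and N: "finite N" "nodes A \<subseteq> N"
  shows "2 * card (A - H) + 3 * card H + 16 \<le> 8 * card N"
proof -
  let ?w = "\<lambda>s. if s \<in> H then 5 else 6 :: nat"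
  have fF: "finite (faces A)" by (rule finite_faces) simp
  have "16 * card (faces A) \<le> (\<Sum>f\<in>faces A. \<Sum>s\<in>bdry A f. sides s * ?w s)"
    using sum_mono[of "faces A" "\<lambda>_. 16" "\<lambda>f. \<Sum>s\<in>bdry A f. sides s * ?w s"]
      face_weight[OF lens half no3 two] by simp
  also have "\<dots> = (\<Sum>s\<in>A. \<Sum>f\<in>inc A s. sides s * ?w s)"
    unfolding bdry_def inc_def by (rule sum.swap_restrict[OF fF finite_A])
  also have "\<dots> \<le> (\<Sum>s\<in>A. 2 * ?w s)"
  proof (rule sum_mono)
    fix s assume "s \<in> A"
    \<comment> \<open>Two faces once each, or one face twice: an edge has two sides in either
      case.\<close>
    then have "card (inc A s) * sides s \<le> 2" using inc_card(2)[of A s] by (auto simp: sides_def)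
    then show "(\<Sum>f\<in>inc A s. sides s * ?w s) \<le> 2 * ?w s"
      using mult_le_mono1[of "card (inc A s) * sides s" 2 "?w s"] by (simp add: mult.assoc)
  qed
  also have "\<dots> = 12 * card (A - H) + 10 * card H"
  proof -
    have "(\<Sum>s\<in>A. 2 * ?w s) = (\<Sum>s\<in>A - H. 2 * ?w s) + (\<Sum>s\<in>H. 2 * ?w s)"
      using finite_A H by (rule sum.subset_diff[rotated])
    also have "(\<Sum>s\<in>A - H. 2 * ?w s) = (\<Sum>s\<in>A - H. 12)" by (rule sum.cong) auto
    also have "(\<Sum>s\<in>H. 2 * ?w s) = (\<Sum>s\<in>H. 10)" by (rule sum.cong) auto
    finally show ?thesis by simp
  qed
  finally have 1: "16 * card (faces A) \<le> 12 * card (A - H) + 10 * card H" .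
  obtain s where "s \<in> A" using two by (cases "A = {}") auto
  then have "N \<noteq> {}" using N(2) by (auto simp: nodes_def ends_def)
  then have "card A + 2 \<le> card (faces A) + card N" using euler_inequality[OF order_refl N] by blast
  moreover have "card A = card (A - H) + card H"
    using finite_A H by (metis add.commute card_Diff_subset card_mono finite_subset le_add_diff_inverse)
  ultimately show ?thesis using 1 by linarith
qed

end

subsection \<open>Puncturing the sphere\<close>

lemma sphere_chart:
  assumes "q \<in> S2"
  obtains \<phi> \<psi> where "homeomorphism (S2 - {q}) (UNIV :: complex set) \<phi> \<psi>"
proof -
  \<comment> \<open>Any plane through the origin would do; only its dimension matters.\<close>
  define P where "P = {x :: real^3. axis 1 1 \<bullet> x = 0}"
  have ne: "(axis 1 1 :: real^3) \<noteq> 0" by (simp add: axis_eq_0_iff)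
  have 1: "(S2 - {q}) homeomorphic P"
    unfolding S2_def P_def using assms ne
    by (intro homeomorphic_punctured_sphere_hyperplane) (auto simp: S2_def)
  have 2: "P homeomorphic (UNIV :: complex set)"
  proof (rule homeomorphic_affine_sets)
    show "affine P" by (simp add: P_def affine_hyperplane)
    show "aff_dim P = aff_dim (UNIV :: complex set)"
      using ne by (simp add: P_def)
  qed auto
  then show thesis using homeomorphic_trans[OF 1 2] that by (auto simp: homeomorphic_def)
qed

lemma connected_sphere_minus_finite:
  assumes "finite N" "N \<subseteq> S2" "N \<noteq> {}"
  shows "connected (S2 - N)"
proof -
  obtain q where q: "q \<in> N" using assms by blast
  then obtain \<phi> \<psi> where h: "homeomorphism (S2 - {q}) (UNIV :: complex set) \<phi> \<psi>"
    using assms sphere_chart by (metis subsetD)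
  have "connected (UNIV - \<phi> ` (N - {q}))"
    using assms(1) by (intro connected_open_delete_finite) auto
  then have "connected (\<psi> ` (UNIV - \<phi> ` (N - {q})))"
    using h by (intro connected_continuous_image) (auto simp: homeomorphism_def elim: continuous_on_subset)
  moreover have "\<psi> ` (UNIV - \<phi> ` (N - {q})) = S2 - N"
  proof
    show "\<psi> ` (UNIV - \<phi> ` (N - {q})) \<subseteq> S2 - N"
    proof clarify
      fix z assume z: "z \<notin> \<phi> ` (N - {q})"
      have "\<psi> z \<in> S2 - {q}" "\<phi> (\<psi> z) = z" using h by (auto simp: homeomorphism_def)
      then show "\<psi> z \<in> S2 - N" using z by (metis DiffD1 DiffD2 DiffI image_eqI)
    qed
    show "S2 - N \<subseteq> \<psi> ` (UNIV - \<phi> ` (N - {q}))"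
    proof
      fix x assume x: "x \<in> S2 - N"
      then have "x \<in> S2 - {q}" using q by auto
      then have "x = \<psi> (\<phi> x)" using homeomorphism_apply1[OF h] by simp
      moreover have "\<phi> x \<notin> \<phi> ` (N - {q})"
      proof
        assume "\<phi> x \<in> \<phi> ` (N - {q})"
        then obtain y where y: "y \<in> N - {q}" "\<phi> x = \<phi> y" by blast
        then have "y \<in> S2 - {q}" using assms(2) by auto
        then have "y = \<psi> (\<phi> y)" using homeomorphism_apply1[OF h] by simp
        then show False using y x \<open>x = \<psi> (\<phi> x)\<close> by auto
      qed
      ultimately show "x \<in> \<psi> ` (UNIV - \<phi> ` (N - {q}))" by blast
    qed
  qed
  ultimately show ?thesis by simp
qed

text \<open>The centre of projection may fall into a lens, and deleting it there must not disconnect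
  the lens. A chart centred on \<open>C\<close> turns \<open>L\<close> into a connected open subset
  of the plane, where deleting a point is harmless.\<close>

lemma connected_sphere_component_minus_point:
  assumes "closed C" "C \<subseteq> S2" "C \<noteq> {}" "L \<in> components (S2 - C)"
  shows "connected (L - {p})"
proof -
  obtain q where q: "q \<in> C" using assms by blast
  then obtain \<phi> \<psi> where h: "homeomorphism (S2 - {q}) (UNIV :: complex set) \<phi> \<psi>"
    using assms sphere_chart by (metis subsetD)
  have sub: "L \<subseteq> S2 - {q}" "L \<subseteq> S2 - C" using in_components_subset[OF assms(4)] q by auto
  have inv: "\<psi> (\<phi> x) = x" if "x \<in> L" for x
    using homeomorphism_apply1[OF h] sub that by blast
  have "locally connected S2" unfolding S2_def by (rule locally_connected_sphere)
  then have "locally connected (S2 - C)"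
    by (rule locally_diff_closed) (simp add: assms(1,2) closed_subset)
  then have "openin (top_of_set (S2 - C)) L"
    using assms(4) by (rule openin_components_locally_connected)
  then obtain T where T: "open T" "L = (S2 - C) \<inter> T" by (auto simp: openin_open)
  have "\<phi> ` L = \<psi> -` (T - C)"
  proof
    show "\<phi> ` L \<subseteq> \<psi> -` (T - C)" using inv T by auto
    show "\<psi> -` (T - C) \<subseteq> \<phi> ` L"
    proof
      fix z assume "z \<in> \<psi> -` (T - C)"
      moreover have "\<psi> z \<in> S2 - {q}" "\<phi> (\<psi> z) = z" using h by (auto simp: homeomorphism_def)
      ultimately show "z \<in> \<phi> ` L" using T by (intro image_eqI[of _ _ "\<psi> z"]) auto
    qed
  qed
  moreover have "open (\<psi> -` (T - C))"
    using h T(1) assms(1) by (intro open_vimage) (auto simp: homeomorphism_def)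
  ultimately have "open (\<phi> ` L)" by simp
  moreover have "connected (\<phi> ` L)"
    using h sub in_components_connected[OF assms(4)]
    by (intro connected_continuous_image) (auto simp: homeomorphism_def elim: continuous_on_subset)
  ultimately have "connected (\<phi> ` L - {\<phi> p})" by (intro connected_open_delete) auto
  then have "connected (\<psi> ` (\<phi> ` L - {\<phi> p}))"
    using h by (intro connected_continuous_image) (auto simp: homeomorphism_def elim: continuous_on_subset)
  moreover have "\<psi> ` (\<phi> ` L - {\<phi> p}) = L - {p}" if "p \<in> L"
  proof
    show "\<psi> ` (\<phi> ` L - {\<phi> p}) \<subseteq> L - {p}" using inv by auto
    show "L - {p} \<subseteq> \<psi> ` (\<phi> ` L - {\<phi> p})"
    proof
      fix x assume "x \<in> L - {p}"
      then show "x \<in> \<psi> ` (\<phi> ` L - {\<phi> p})"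
        using inv[OF that] inv[of x] by (intro image_eqI[of _ _ "\<phi> x"]) auto
    qed
  qed
  ultimately show ?thesis
    using in_components_connected[OF assms(4)] by (cases "p \<in> L") auto
qed

subsection \<open>The planarization of a one-planar drawing\<close>

locale one_planar =
  fixes V :: "'v set" and E :: "'e set" and src tgt :: "'e \<Rightarrow> 'v"
    and pos :: "'v \<Rightarrow> real^3" and \<gamma> :: "'e \<Rightarrow> real \<Rightarrow> real^3"
  assumes multigraph: "multigraph V E src tgt"
    and conn: "connected_graph V E src tgt"
    and card_V: "3 \<le> card V"
    and drawing: "drawing V E src tgt pos \<gamma>"
    and planar: "k_planar_drawing 1 E \<gamma>"
    and non_homotopic: "non_homotopic_drawing V E pos \<gamma>"
begin

definition X where "X = crossing_points E \<gamma>"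

definition crossed where "crossed e \<longleftrightarrow> crossings_on E \<gamma> e \<noteq> {}"

text \<open>The choice is unique for a crossed edge, which has a single crossing and an injective
  parametrization.\<close>

definition \<tau> where
  "\<tau> e = (if crossed e then SOME t. 0 < t \<and> t < 1 \<and> \<gamma> e t \<in> crossings_on E \<gamma> e else 1)"

fun lo where "lo (e, b) = (if b then 0 else \<tau> e)"
fun hi where "hi (e, b) = (if b then \<tau> e else 1)"

text \<open>An uncrossed edge \<open>e\<close> is the single segment \<open>(e, True)\<close>, as then \<open>\<tau> e = 1\<close>; a crossed edge has the
  two segments \<open>(e, True)\<close> and \<open>(e, False)\<close>.\<close>

definition \<sigma> where "\<sigma> s = subpath (lo s) (hi s) (\<gamma> (fst s))"

definition H where "H = {e \<in> E. crossed e} \<times> (UNIV :: bool set)"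

definition A where "A = E \<times> {True} \<union> H"

lemma finite_E: "finite E" and finite_V: "finite V"
  using multigraph by (auto simp: multigraph_def)

lemma edge_ends: "e \<in> E \<Longrightarrow> src e \<in> V \<and> tgt e \<in> V \<and> src e \<noteq> tgt e"
  using multigraph by (auto simp: multigraph_def)

lemma arc_\<gamma>: "e \<in> E \<Longrightarrow> arc (\<gamma> e)"
  and \<gamma>_S2: "e \<in> E \<Longrightarrow> path_image (\<gamma> e) \<subseteq> S2"
  and \<gamma>_0: "e \<in> E \<Longrightarrow> \<gamma> e 0 = pos (src e)"
  and \<gamma>_1: "e \<in> E \<Longrightarrow> \<gamma> e 1 = pos (tgt e)"
  using drawing by (auto simp: drawing_def pathstart_def pathfinish_def)

lemma inj_pos: "inj_on pos V"
  using drawing by (auto simp: drawing_def)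

lemma vertex_not_interior: "\<lbrakk>e \<in> E; v \<in> V\<rbrakk> \<Longrightarrow> pos v \<notin> arc_interior (\<gamma> e)"
  using drawing by (auto simp: drawing_def)

lemma no_triple: "\<lbrakk>e \<in> E; f \<in> E; g \<in> E; e \<noteq> f; e \<noteq> g; f \<noteq> g\<rbrakk> \<Longrightarrow>
    arc_interior (\<gamma> e) \<inter> arc_interior (\<gamma> f) \<inter> arc_interior (\<gamma> g) = {}"
proof -
  assume a: "e \<in> E" "f \<in> E" "g \<in> E" "e \<noteq> f" "e \<noteq> g" "f \<noteq> g"
  then have "arc_interior (\<gamma> e) \<inter> arc_interior (\<gamma> f) \<inter> path_image (\<gamma> g) = {}"
    using drawing unfolding drawing_def by blast
  moreover have "arc_interior (\<gamma> g) \<subseteq> path_image (\<gamma> g)"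
    by (auto simp: arc_interior_def path_image_def)
  ultimately show ?thesis by blast
qed

lemma inj_\<gamma>: "\<lbrakk>e \<in> E; \<gamma> e u = \<gamma> e v; 0 \<le> u; u \<le> 1; 0 \<le> v; v \<le> 1\<rbrakk> \<Longrightarrow> u = v"
  using arc_\<gamma>[of e] by (auto simp: arc_def inj_on_def)

lemma \<tau>_crossed:
  assumes "e \<in> E" "crossed e"
  shows "0 < \<tau> e" "\<tau> e < 1" "crossings_on E \<gamma> e = {\<gamma> e (\<tau> e)}"
proof -
  obtain p where p: "p \<in> crossings_on E \<gamma> e" using assms by (auto simp: crossed_def)
  then have "p \<in> \<gamma> e ` {0<..<1}" by (simp add: crossings_on_def arc_interior_def)
  then have "\<exists>t. 0 < t \<and> t < 1 \<and> \<gamma> e t \<in> crossings_on E \<gamma> e" using p by auto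
  then have *: "0 < \<tau> e \<and> \<tau> e < 1 \<and> \<gamma> e (\<tau> e) \<in> crossings_on E \<gamma> e"
    unfolding \<tau>_def using assms(2) by simp (rule someI_ex)
  then show "0 < \<tau> e" "\<tau> e < 1" by auto
  have "finite (crossings_on E \<gamma> e)" "card (crossings_on E \<gamma> e) \<le> 1"
    using planar assms(1) by (auto simp: k_planar_drawing_def)
  then show "crossings_on E \<gamma> e = {\<gamma> e (\<tau> e)}"
    using * by (auto simp: card_le_Suc0_iff_eq)
qed

lemma \<tau>_range: assumes "e \<in> E" shows "0 < \<tau> e \<and> \<tau> e \<le> 1"
proof (cases "crossed e")
  case True
  then show ?thesis using \<tau>_crossed(1,2)[OF assms] by simp
qed (simp add: \<tau>_def)

lemma A_cases: "(e, b) \<in> A \<longleftrightarrow> e \<in> E \<and> (b \<or> crossed e)"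
  by (auto simp: A_def H_def)

lemma lo_hi: "(e, b) \<in> A \<Longrightarrow> e \<in> E \<and> 0 \<le> lo (e, b) \<and> lo (e, b) < hi (e, b) \<and> hi (e, b) \<le> 1"
  using \<tau>_range[of e] \<tau>_crossed(1,2)[of e] by (auto simp: A_cases)

lemma image_\<sigma>: "(e, b) \<in> A \<Longrightarrow> path_image (\<sigma> (e, b)) = \<gamma> e ` {lo (e, b)..hi (e, b)}"
  using lo_hi[of e b] by (simp add: \<sigma>_def path_image_subpath del: lo.simps hi.simps)

lemma image_\<sigma>_subset: "(e, b) \<in> A \<Longrightarrow> path_image (\<sigma> (e, b)) \<subseteq> path_image (\<gamma> e)"
  using lo_hi[of e b] image_\<sigma>[of e b] by (auto simp: path_image_def simp del: lo.simps hi.simps)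

lemma arc_\<sigma>: "s \<in> A \<Longrightarrow> arc (\<sigma> s)"
  using lo_hi[of "fst s" "snd s"] arc_\<gamma>[of "fst s"]
  by (auto simp: \<sigma>_def simp del: lo.simps hi.simps intro!: arc_subpath_arc)

lemma start_\<sigma>: "pathstart (\<sigma> (e, b)) = \<gamma> e (lo (e, b))"
  and finish_\<sigma>: "pathfinish (\<sigma> (e, b)) = \<gamma> e (hi (e, b))"
  by (simp_all add: \<sigma>_def)

text \<open>A point interior to both edges is the one crossing of \<open>e\<close>; an end of
  \<open>f\<close> is a vertex and thus not interior to \<open>e\<close>.\<close>

lemma interior_meet:
  assumes "e \<in> E" "f \<in> E" "e \<noteq> f" "p \<in> path_image (\<gamma> e)" "p \<in> path_image (\<gamma> f)"
  shows "p \<in> {\<gamma> e 0, \<gamma> e 1} \<or> crossed e \<and> p = \<gamma> e (\<tau> e)"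
proof (rule disjCI)
  have im: "path_image (\<gamma> g) = insert (\<gamma> g 0) (insert (\<gamma> g 1) (arc_interior (\<gamma> g)))" for g
  proof -
    have "{0..1} = insert 0 (insert 1 {0<..<1::real})" by auto
    then show ?thesis by (auto simp: path_image_def arc_interior_def)
  qed
  assume "\<not> (crossed e \<and> p = \<gamma> e (\<tau> e))"
  then have "p \<notin> crossings_on E \<gamma> e" using \<tau>_crossed(3)[OF assms(1)] by (auto simp: crossed_def)
  then have "p \<notin> arc_interior (\<gamma> e) \<or> p \<notin> arc_interior (\<gamma> f)"
    using assms by (auto simp: crossings_on_def)
  moreover have "p \<notin> arc_interior (\<gamma> e)" if "p \<in> {\<gamma> f 0, \<gamma> f 1}"
    using that vertex_not_interior[OF assms(1)] edge_ends[OF assms(2)] \<gamma>_0[OF assms(2)] \<gamma>_1[OF assms(2)]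
    by auto
  ultimately show "p \<in> {\<gamma> e 0, \<gamma> e 1}" using assms im by blast
qed

lemma meet_\<sigma>:
  assumes "s \<in> A" "t \<in> A" "s \<noteq> t"
  shows "path_image (\<sigma> s) \<inter> path_image (\<sigma> t) \<subseteq> {pathstart (\<sigma> s), pathfinish (\<sigma> s)}"
proof
  fix p assume p: "p \<in> path_image (\<sigma> s) \<inter> path_image (\<sigma> t)"
  obtain e b f b' where st: "s = (e, b)" "t = (f, b')" by (cases s, cases t)
  have e: "e \<in> E" "f \<in> E" using assms st by (auto simp: A_cases)
  have "p \<in> \<gamma> e ` {lo s..hi s}" using p assms(1) image_\<sigma>[of e b] st by blast
  then obtain u where u: "p = \<gamma> e u" "lo s \<le> u" "u \<le> hi s" by auto
  have u01: "0 \<le> u" "u \<le> 1" using u lo_hi assms st by fastforce+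
  show "p \<in> {pathstart (\<sigma> s), pathfinish (\<sigma> s)}"
  proof (cases "e = f")
    case True
    have "p \<in> \<gamma> e ` {lo t..hi t}" using p assms(2) image_\<sigma>[of f b'] st True by blast
    then obtain w where w: "p = \<gamma> e w" "lo t \<le> w" "w \<le> hi t" by auto
    have "0 \<le> w" "w \<le> 1" using w lo_hi assms st by fastforce+
    then have "u = w" using inj_\<gamma>[OF e(1)] u w u01 by auto
    then have "u = \<tau> e" using u w st assms(3) True by (auto split: if_splits)
    then show ?thesis using u st by (auto simp: start_\<sigma> finish_\<sigma>)
  next
    case False
    have "p \<in> path_image (\<gamma> e)" "p \<in> path_image (\<gamma> f)"
      using p assms st image_\<sigma>_subset by blast+
    from interior_meet[OF e False this]
    have "u = 0 \<or> u = 1 \<or> u = \<tau> e"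
      using inj_\<gamma>[OF e(1)] u(1) u01 \<tau>_range[OF e(1)] by auto
    \<comment> \<open>Of the parameters 0, \<open>\<tau> e\<close> and 1, those within the range of
      \<open>s\<close> are its ends.\<close>
    then have "u = lo s \<or> u = hi s" using u st \<tau>_range[OF e(1)] by (auto split: if_splits)
    then show ?thesis using u st by (auto simp: start_\<sigma> finish_\<sigma>)
  qed
qed

section \<open>Vertices and crossings as nodes\<close>

lemma X_disjoint: "X \<inter> pos ` V = {}"
  using vertex_not_interior by (fastforce simp: X_def crossing_points_def crossings_on_def)

lemma crossing_in_X: "\<lbrakk>e \<in> E; crossed e\<rbrakk> \<Longrightarrow> \<gamma> e (\<tau> e) \<in> X"
  using \<tau>_crossed(3)[of e] by (auto simp: X_def crossing_points_def)

lemma X_crossing: "p \<in> X \<Longrightarrow> \<exists>e\<in>E. crossed e \<and> p = \<gamma> e (\<tau> e)"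
  using \<tau>_crossed(3) by (fastforce simp: X_def crossing_points_def crossed_def)

lemma finite_X: "finite X"
proof -
  have "X \<subseteq> (\<lambda>e. \<gamma> e (\<tau> e)) ` E" using X_crossing by blast
  then show ?thesis using finite_E by (meson finite_imageI finite_subset)
qed

lemma ends_crossed:
  assumes "e \<in> E" "crossed e"
  shows "{pathstart (\<sigma> (e, b)), pathfinish (\<sigma> (e, b))} =
    {\<gamma> e (\<tau> e), pos (if b then src e else tgt e)}"
  using assms \<gamma>_0 \<gamma>_1 by (auto simp: start_\<sigma> finish_\<sigma>)

lemma ends_uncrossed:
  assumes "e \<in> E" "\<not> crossed e"
  shows "{pathstart (\<sigma> (e, True)), pathfinish (\<sigma> (e, True))} = {pos (src e), pos (tgt e)}"
  using assms \<gamma>_0 \<gamma>_1 by (auto simp: start_\<sigma> finish_\<sigma> \<tau>_def)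

lemma ends_subset_nodes:
  assumes "s \<in> A" shows "{pathstart (\<sigma> s), pathfinish (\<sigma> s)} \<subseteq> pos ` V \<union> X"
proof -
  obtain e b where s: "s = (e, b)" by (cases s)
  then have e: "e \<in> E" "b \<or> crossed e" using assms by (auto simp: A_cases)
  then show ?thesis
    using s edge_ends[OF e(1)] ends_crossed[OF e(1), of b] ends_uncrossed[OF e(1)] crossing_in_X[OF e(1)]
    by (cases "crossed e") (auto split: if_splits)
qed

text \<open>Here connectedness enters: the walk to some other vertex has a first edge.\<close>

lemma vertex_on_edge: assumes "v \<in> V" shows "\<exists>e\<in>E. v = src e \<or> v = tgt e"
proof -
  have "\<not> V \<subseteq> {v}" using card_V card_mono[of "{v}" V] by auto
  then obtain u where u: "u \<in> V" "u \<noteq> v" by blast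
  then have "(adjacent E src tgt)\<^sup>*\<^sup>* v u" using conn assms by (auto simp: connected_graph_def)
  then obtain w where "adjacent E src tgt v w" using u(2) by (metis converse_rtranclpE)
  then show ?thesis by (auto simp: adjacent_def doubleton_eq_iff)
qed

text \<open>Excludes the drawing of a single edge, whose only face would receive at most 12. Two
  edges are forced because each covers two of at least three vertices.\<close>

lemma card_E: "2 \<le> card E"
proof -
  have "V \<subseteq> src ` E \<union> tgt ` E" using vertex_on_edge by blast
  then have "card V \<le> card (src ` E \<union> tgt ` E)" using finite_E by (intro card_mono) auto
  also have "\<dots> \<le> card (src ` E) + card (tgt ` E)" by (rule card_Un_le)
  also have "\<dots> \<le> card E + card E" using finite_E by (intro add_mono card_image_le)
  finally show ?thesis using card_V by linarith
qed

lemma nodes_covered: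
  assumes "p \<in> pos ` V \<union> X"
  shows "\<exists>s\<in>A. p \<in> {pathstart (\<sigma> s), pathfinish (\<sigma> s)}"
  using assms
proof
  assume "p \<in> X"
  then obtain e where e: "e \<in> E" "crossed e" "p = \<gamma> e (\<tau> e)" using X_crossing by blast
  then show ?thesis using ends_crossed[OF e(1,2), of True]
    by (intro bexI[of _ "(e, True)"]) (auto simp: A_cases)
next
  assume "p \<in> pos ` V"
  then obtain v where v: "v \<in> V" "p = pos v" by blast
  then obtain e where e: "e \<in> E" "v = src e \<or> v = tgt e" using vertex_on_edge by blast
  show ?thesis
  proof (cases "crossed e")
    case True
    then show ?thesis using ends_crossed[OF e(1) True, of "v = src e"] e v
      by (intro bexI[of _ "(e, v = src e)"]) (auto simp: A_cases)
  next
    case False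
    then show ?thesis using ends_uncrossed[OF e(1) False] e v
      by (intro bexI[of _ "(e, True)"]) (auto simp: A_cases)
  qed
qed

section \<open>Counting segments\<close>

lemma finite_A: "finite A"
  using finite_E by (auto simp: A_def H_def)

lemma H_subset: "H \<subseteq> A"
  by (auto simp: A_def)

lemma card_A: "2 \<le> card A"
proof -
  have "card (E \<times> {True}) \<le> card A" using finite_A by (intro card_mono) (auto simp: A_def)
  then show ?thesis using card_E by (simp add: card_cartesian_product)
qed

text \<open>Sending a crossed edge to its crossing is two-to-one: a second edge exists by
  definition, a third is excluded by \<open>no_triple\<close>.\<close>

lemma card_crossed: "card {e \<in> E. crossed e} = 2 * card X"
proof -
  let ?C = "{e \<in> E. crossed e}"
  have fib: "card {e \<in> ?C. \<gamma> e (\<tau> e) = p} = 2" if pX: "p \<in> X" for p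
  proof -
    obtain e where e: "e \<in> E" "crossed e" "p = \<gamma> e (\<tau> e)" using X_crossing[OF pX] by blast
    then have pe: "p \<in> crossings_on E \<gamma> e" using \<tau>_crossed(3) by blast
    then obtain f where f: "f \<in> E" "f \<noteq> e" "p \<in> arc_interior (\<gamma> f)" "p \<in> arc_interior (\<gamma> e)"
      by (auto simp: crossings_on_def)
    then have "p \<in> crossings_on E \<gamma> f" using e(1) by (auto simp: crossings_on_def)
    then have f': "crossed f" "p = \<gamma> f (\<tau> f)" using \<tau>_crossed(3)[OF f(1)] by (auto simp: crossed_def)
    have "g \<in> {e, f}" if g: "g \<in> ?C" "\<gamma> g (\<tau> g) = p" for g
    proof (rule ccontr)
      assume "g \<notin> {e, f}"
      moreover have "p \<in> arc_interior (\<gamma> g)"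
        using g \<tau>_crossed(3)[of g] by (auto simp: crossings_on_def)
      ultimately show False using no_triple[of e f g] e f g by blast
    qed
    then have "{e \<in> ?C. \<gamma> e (\<tau> e) = p} = {e, f}" using e f f' by auto
    then show ?thesis using f by simp
  qed
  have "(\<Sum>p\<in>X. \<Sum>e\<in>{e \<in> ?C. \<gamma> e (\<tau> e) = p}. 1) = (\<Sum>e\<in>?C. 1::nat)"
    using finite_E finite_X crossing_in_X by (intro sum.group) auto
  then show ?thesis using fib by simp
qed

lemma card_H: "card H = 4 * card X"
  by (simp add: H_def card_cartesian_product card_crossed)

lemma card_uncrossed: "card (A - H) + 2 * card X = card E"
proof -
  have "A - H = (E - {e \<in> E. crossed e}) \<times> {True}" by (auto simp: A_def H_def)
  then have "card (A - H) = card E - card {e \<in> E. crossed e}"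
    using finite_E by (simp add: card_cartesian_product card_Diff_subset)
  moreover have "card {e \<in> E. crossed e} \<le> card E" using finite_E by (intro card_mono) auto
  ultimately show ?thesis using card_crossed by linarith
qed

section \<open>Parallel segments\<close>

lemma parallel_distinct_edges:
  assumes "(e, b) \<in> A" "(f, b') \<in> A" "(e, b) \<noteq> (f, b')"
    "{pathstart (\<sigma> (e, b)), pathfinish (\<sigma> (e, b))} = {pathstart (\<sigma> (f, b')), pathfinish (\<sigma> (f, b'))}"
  shows "e \<noteq> f"
proof
  assume "e = f"
  then have e: "e \<in> E" "crossed e" "b' = (\<not> b)" using assms by (auto simp: A_cases)
  \<comment> \<open>The two halves of one edge share the crossing but end at different
    vertices.\<close>
  have "{\<gamma> e (\<tau> e), pos (if b then src e else tgt e)} = {\<gamma> e (\<tau> e), pos (if b' then src e else tgt e)}"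
    using assms(4) ends_crossed[OF e(1,2)] \<open>e = f\<close> by simp
  then have "pos (src e) = pos (tgt e)" using e(3) by (auto simp: doubleton_eq_iff split: if_splits)
  then show False using edge_ends[OF e(1)] inj_pos by (auto dest: inj_onD)
qed

text \<open>Makes non-homotopy available for the planarization: by \<open>meet_\<sigma>\<close>
  parallel segments meet in their ends only.\<close>

lemma lens_of_parallel:
  assumes "s \<in> A" "t \<in> A" "s \<noteq> t"
    "{pathstart (\<sigma> s), pathfinish (\<sigma> s)} = {pathstart (\<sigma> t), pathfinish (\<sigma> t)}"
  shows "lens_boundary E \<gamma> (path_image (\<sigma> s) \<union> path_image (\<sigma> t))"
proof -
  obtain e b f b' where st: "s = (e, b)" "t = (f, b')" by (cases s, cases t)
  have 1: "e \<in> E" "0 \<le> lo s" "lo s < hi s" "hi s \<le> 1" using lo_hi assms st by auto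
  have 2: "f \<in> E" "0 \<le> lo t" "lo t < hi t" "hi t \<le> 1" using lo_hi assms st by auto
  have e: "{\<gamma> e (lo s), \<gamma> e (hi s)} = {\<gamma> f (lo t), \<gamma> f (hi t)}"
    using assms(4) st by (simp add: start_\<sigma> finish_\<sigma> del: lo.simps hi.simps)
  have "path_image (\<sigma> s) \<inter> path_image (\<sigma> t) = {pathstart (\<sigma> s), pathfinish (\<sigma> s)}"
  proof (rule equalityI[OF meet_\<sigma>[OF assms(1-3)]])
    have "{pathstart g, pathfinish g} \<subseteq> path_image g" for g :: "real \<Rightarrow> real^3"
      by (simp add: pathstart_in_path_image pathfinish_in_path_image)
    then show "{pathstart (\<sigma> s), pathfinish (\<sigma> s)} \<subseteq> path_image (\<sigma> s) \<inter> path_image (\<sigma> t)"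
      using assms(4) by (metis Int_greatest)
  qed
  then have i: "path_image (\<sigma> s) \<inter> path_image (\<sigma> t) = {\<gamma> e (lo s), \<gamma> e (hi s)}"
    using st by (simp add: start_\<sigma> finish_\<sigma> del: lo.simps hi.simps)
  have "\<sigma> s = subpath (lo s) (hi s) (\<gamma> e)" "\<sigma> t = subpath (lo t) (hi t) (\<gamma> f)"
    using st by (simp_all add: \<sigma>_def)
  then show ?thesis unfolding lens_boundary_def using 1 2 e i by metis
qed

section \<open>From the sphere to the plane\<close>

lemma drawing_not_onto: "\<exists>p\<in>S2. \<forall>s\<in>A. p \<notin> path_image (\<sigma> s)"
proof (rule ccontr)
  assume "\<not> ?thesis"
  then have cover: "S2 \<subseteq> (\<Union>s\<in>A. path_image (\<sigma> s))" by blast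
  \<comment> \<open>Off the finite set \<open>N\<close>, one segment and the union of the others are
    disjoint relatively closed sets, neither of them empty. If they covered the sphere they would
    disconnect \<open>S2 - N\<close>.\<close>
  define N where "N = (\<Union>s\<in>A. {pathstart (\<sigma> s), pathfinish (\<sigma> s)})"
  have sub: "path_image (\<sigma> s) \<subseteq> S2" if "s \<in> A" for s
    using that image_\<sigma>_subset[of "fst s" "snd s"] \<gamma>_S2[of "fst s"] by (cases s) (auto simp: A_cases)
  obtain s where s: "s \<in> A" using card_A by (cases "A = {}") auto
  have "\<not> A \<subseteq> {s}" using card_A card_mono[of "{s}" A] by auto
  then obtain t where t: "t \<in> A" "t \<noteq> s" by blast
  have "\<exists>p\<in>path_image (\<sigma> r). p \<notin> N" if r: "r \<in> A" for r
  proof -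
    have "finite N" using finite_A by (simp add: N_def)
    moreover have "infinite (path_image (\<sigma> r))"
    proof -
      have "inj_on (\<sigma> r) {0..1}" using arc_\<sigma>[OF r] by (simp add: arc_def)
      then show ?thesis using infinite_Icc[of 0 "1::real"] by (simp add: path_image_def finite_image_iff)
    qed
    ultimately show ?thesis by (metis finite_subset subsetI)
  qed
  then obtain p q where p: "p \<in> path_image (\<sigma> s)" "p \<notin> N" and q: "q \<in> path_image (\<sigma> t)" "q \<notin> N"
    using s t by blast
  have NS: "N \<subseteq> S2" using sub by (force simp: N_def)
  have "connected (S2 - N)"
  proof (rule connected_sphere_minus_finite[OF _ NS])
    show "finite N" using finite_A by (simp add: N_def)
    show "N \<noteq> {}" using s unfolding N_def by blast
  qed
  moreover have cl: "closed (path_image (\<sigma> r))" if "r \<in> A" for r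
    using arc_\<sigma>[OF that] by (rule closed_arc_image)
  then have "closed (path_image (\<sigma> s))" "closed (\<Union>r\<in>A - {s}. path_image (\<sigma> r))"
    using s finite_A by (auto intro!: closed_UN)
  moreover have "S2 - N \<subseteq> path_image (\<sigma> s) \<union> (\<Union>r\<in>A - {s}. path_image (\<sigma> r))"
    using cover by blast
  moreover have "path_image (\<sigma> s) \<inter> (\<Union>r\<in>A - {s}. path_image (\<sigma> r)) \<inter> (S2 - N) = {}"
    using meet_\<sigma>[OF s] s by (fastforce simp: N_def)
  moreover have "path_image (\<sigma> s) \<inter> (S2 - N) \<noteq> {}" using p sub[OF s] by blast
  moreover have "(\<Union>r\<in>A - {s}. path_image (\<sigma> r)) \<inter> (S2 - N) \<noteq> {}" using q sub[OF t(1)] t by blast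
  ultimately show False unfolding connected_closed by blast
qed

lemma edge_bound: "card E + 8 \<le> 4 * card V"
proof -
  obtain p0 where p0: "p0 \<in> S2" "\<And>s. s \<in> A \<Longrightarrow> p0 \<notin> path_image (\<sigma> s)"
    using drawing_not_onto by blast
  obtain \<phi> \<psi> where h: "homeomorphism (S2 - {p0}) (UNIV :: complex set) \<phi> \<psi>"
    using sphere_chart[OF p0(1)] .
  define c where "c s = \<phi> \<circ> \<sigma> s" for s
  have sub: "path_image (\<sigma> s) \<subseteq> S2 - {p0}" if "s \<in> A" for s
    using that image_\<sigma>_subset[of "fst s" "snd s"] \<gamma>_S2[of "fst s"] p0(2)[OF that]
    by (cases s) (auto simp: A_cases)
  have inj: "inj_on \<phi> (S2 - {p0})" using homeomorphism_apply1[OF h] by (rule inj_on_inverseI)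
  have cont: "continuous_on (S2 - {p0}) \<phi>" "continuous_on UNIV \<psi>"
    using h by (auto simp: homeomorphism_def)
  have \<psi>: "\<psi> z \<in> S2 - {p0}" "\<phi> (\<psi> z) = z" for z using h by (auto simp: homeomorphism_def)
  have im: "path_image (c s) = \<phi> ` path_image (\<sigma> s)" for s by (simp add: c_def path_image_compose)
  have st: "pathstart (c s) = \<phi> (pathstart (\<sigma> s))" "pathfinish (c s) = \<phi> (pathfinish (\<sigma> s))" for s
    by (simp_all add: c_def pathstart_compose pathfinish_compose)
  interpret arc_system A c
  proof
    show "finite A" by (rule finite_A)
    show "arc (c s)" if "s \<in> A" for s
    proof -
      have "path (c s)" unfolding c_def
        using arc_\<sigma>[OF that] sub[OF that] cont(1)
        by (intro path_continuous_image) (auto intro: arc_imp_path elim: continuous_on_subset)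
      moreover have "inj_on (c s) {0..1}"
        unfolding c_def using arc_\<sigma>[OF that] sub[OF that] inj_on_subset[OF inj]
        by (intro comp_inj_on) (auto simp: arc_def path_image_def)
      ultimately show ?thesis by (simp add: arc_def)
    qed
    show "path_image (c s) \<inter> path_image (c t) \<subseteq> {pathstart (c s), pathfinish (c s)}"
      if "s \<in> A" "t \<in> A" "s \<noteq> t" for s t
    proof -
      have "path_image (c s) \<inter> path_image (c t) = \<phi> ` (path_image (\<sigma> s) \<inter> path_image (\<sigma> t))"
        unfolding im using inj_on_image_Int[OF inj sub[OF that(1)] sub[OF that(2)]] by simp
      then show ?thesis using meet_\<sigma>[OF that] st by auto
    qed
  qed
  have ends_c: "ends s = \<phi> ` {pathstart (\<sigma> s), pathfinish (\<sigma> s)}" for s by (simp add: ends_def st)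
  have ends_sub: "{pathstart (\<sigma> s), pathfinish (\<sigma> s)} \<subseteq> S2 - {p0}" if "s \<in> A" for s
    using sub[OF that] by auto
  have nodes_sub: "pos ` V \<union> X \<subseteq> S2 - {p0}"
    using nodes_covered ends_sub by blast
  have nodes_A: "nodes A \<subseteq> \<phi> ` (pos ` V \<union> X)"
    using ends_subset_nodes by (fastforce simp: nodes_def ends_c)
  have in_nodes: "\<phi> p \<in> nodes A" if "p \<in> pos ` V \<union> X" for p
    using nodes_covered[OF that] by (auto simp: nodes_def ends_c)
  have ends_eq: "{pathstart (\<sigma> s), pathfinish (\<sigma> s)} = {pathstart (\<sigma> t), pathfinish (\<sigma> t)}"
    if "s \<in> A" "t \<in> A" "ends s = ends t" for s t
    using that(3) inj_on_image_eq_iff[OF inj ends_sub[OF that(1)] ends_sub[OF that(2)]] by (simp add: ends_c)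
  have lens: "D \<inter> nodes A \<noteq> {}"
    if stA: "s \<in> A" "t \<in> A" "s \<noteq> t" "ends s = ends t"
      and D: "D \<in> components (- (path_image (c s) \<union> path_image (c t)))" for s t D
  proof -
    define C where "C = path_image (\<sigma> s) \<union> path_image (\<sigma> t)"
    have C: "C \<subseteq> S2 - {p0}" using sub stA by (auto simp: C_def)
    have lb: "lens_boundary E \<gamma> C"
      unfolding C_def using lens_of_parallel[OF stA(1-3) ends_eq[OF stA(1,2,4)]] .
    have \<phi>C: "path_image (c s) \<union> path_image (c t) = \<phi> ` C" by (simp add: im C_def image_Un)
    have "connected (\<psi> ` D)"
      using in_components_connected[OF D] cont(2)
      by (intro connected_continuous_image) (auto elim: continuous_on_subset)
    moreover have "\<psi> ` D \<subseteq> S2 - C"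
    proof
      fix x assume "x \<in> \<psi> ` D"
      then obtain z where z: "z \<in> D" "x = \<psi> z" by blast
      then have "z \<notin> \<phi> ` C" using in_components_subset[OF D] \<phi>C by auto
      then show "x \<in> S2 - C" using \<psi>[of z] z(2) by (metis DiffD1 DiffI image_eqI)
    qed
    moreover have "\<psi> ` D \<noteq> {}" using in_components_nonempty[OF D] by simp
    ultimately obtain L where L: "L \<in> components (S2 - C)" "\<psi> ` D \<subseteq> L"
      using exists_component_superset[of "\<psi> ` D" "S2 - C"] by blast
    obtain v where v: "v \<in> L" "v \<in> pos ` V \<union> X"
      using non_homotopic lb L(1) unfolding non_homotopic_drawing_def X_def by blast
    have cl: "closed C" using arc_\<sigma> stA by (simp add: C_def closed_Un closed_arc_image)
    have "connected (L - {p0})"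
      using C L(1) cl by (intro connected_sphere_component_minus_point[of C]) (auto simp: C_def)
    moreover have LS: "L - {p0} \<subseteq> S2 - {p0} - C" using in_components_subset[OF L(1)] by blast
    ultimately have "connected (\<phi> ` (L - {p0}))"
      using cont(1) by (intro connected_continuous_image) (auto elim: continuous_on_subset)
    moreover have "\<phi> ` (L - {p0}) \<subseteq> - \<phi> ` C"
      using inj_on_image_set_diff[OF inj, of "S2 - {p0}" C] C LS by blast
    moreover have "D \<inter> \<phi> ` (L - {p0}) \<noteq> {}"
    proof -
      obtain z where "z \<in> D" using in_components_nonempty[OF D] by blast
      then have "\<psi> z \<in> L - {p0}" "\<phi> (\<psi> z) = z" using L(2) \<psi> by blast+
      then show ?thesis using \<open>z \<in> D\<close> by (metis IntI empty_iff image_eqI)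
    qed
    ultimately have "\<phi> ` (L - {p0}) \<subseteq> D"
      using components_maximal[OF D] \<phi>C by auto
    moreover have "v \<in> L - {p0}" using v nodes_sub by blast
    ultimately show ?thesis using in_nodes[OF v(2)] by blast
  qed
  have half: "\<exists>x v. ends s = {x, v} \<and> x \<in> \<phi> ` X \<and> v \<notin> \<phi> ` X" if sH: "s \<in> H" for s
  proof -
    obtain e b where s: "s = (e, b)" "e \<in> E" "crossed e" using sH by (auto simp: H_def)
    let ?v = "pos (if b then src e else tgt e)"
    have v: "?v \<in> pos ` V" using edge_ends[OF s(2)] by auto
    then have "?v \<notin> X" using X_disjoint by blast
    then have "\<phi> ?v \<notin> \<phi> ` X"
      using v nodes_sub inj_on_image_mem_iff[OF inj, of ?v X] by blast
    then show ?thesis using s crossing_in_X[OF s(2,3)]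
      by (intro exI[of _ "\<phi> (\<gamma> e (\<tau> e))"] exI[of _ "\<phi> ?v"]) (simp add: ends_c ends_crossed)
  qed
  have no3: False
    if H3: "s \<in> H" "t \<in> H" "u \<in> H" and ne: "s \<noteq> t" "s \<noteq> u" "t \<noteq> u"
      and eq: "ends s = ends t" "ends u = ends s" for s t u
  proof -
    obtain e1 b1 e2 b2 e3 b3 where d: "s = (e1, b1)" "t = (e2, b2)" "u = (e3, b3)"
      by (cases s, cases t, cases u)
    have HA: "s \<in> A" "t \<in> A" "u \<in> A" using H3 H_subset by auto
    have e: "e1 \<in> E" "e2 \<in> E" "e3 \<in> E" "crossed e1" "crossed e2" "crossed e3"
      using H3 d by (auto simp: H_def)
    have ne': "e1 \<noteq> e2" "e1 \<noteq> e3" "e2 \<noteq> e3"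
      using parallel_distinct_edges HA ends_eq eq ne d by metis+
    have pt: "\<gamma> e (\<tau> e) \<in> {pathstart (\<sigma> (e, b)), pathfinish (\<sigma> (e, b))} \<inter> X" if "e \<in> E" "crossed e" for e b
      using ends_crossed[OF that, of b] crossing_in_X[OF that] by auto
    have uniq: "p = \<gamma> e (\<tau> e)" if "e \<in> E" "crossed e" "p \<in> {pathstart (\<sigma> (e, b)), pathfinish (\<sigma> (e, b))} \<inter> X" for e b p
      using that(3) ends_crossed[OF that(1,2), of b] X_disjoint edge_ends[OF that(1)] by (auto split: if_splits)
    have E12: "{pathstart (\<sigma> s), pathfinish (\<sigma> s)} = {pathstart (\<sigma> t), pathfinish (\<sigma> t)}"
      using ends_eq[OF HA(1,2) eq(1)] .
    have E13: "{pathstart (\<sigma> u), pathfinish (\<sigma> u)} = {pathstart (\<sigma> s), pathfinish (\<sigma> s)}"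
      using ends_eq[OF HA(3,1) eq(2)] .
    have "\<gamma> e1 (\<tau> e1) = \<gamma> e2 (\<tau> e2)" using uniq[OF e(2,5)] pt[OF e(1,4), of b1] E12 d by metis
    moreover have "\<gamma> e1 (\<tau> e1) = \<gamma> e3 (\<tau> e3)" using uniq[OF e(3,6)] pt[OF e(1,4), of b1] E13 d by metis
    moreover have "\<gamma> e (\<tau> e) \<in> arc_interior (\<gamma> e)" if "e \<in> E" "crossed e" for e
      using \<tau>_crossed(1,2)[OF that] by (auto simp: arc_interior_def)
    ultimately show False using no_triple[OF e(1-3) ne'] e by (metis IntI empty_iff)
  qed
  have fin: "finite (\<phi> ` (pos ` V \<union> X))" using finite_V finite_X by simp
  have "2 * card (A - H) + 3 * card H + 16 \<le> 8 * card (\<phi> ` (pos ` V \<union> X))"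
  proof (rule weighted_edge_bound[OF _ _ _ card_A H_subset fin nodes_A])
    show "\<exists>x v. ends s = {x, v} \<and> x \<in> \<phi> ` X \<and> v \<notin> \<phi> ` X" if "s \<in> H" for s
      by (rule half[OF that])
  qed (fact lens no3)+
  moreover have "card (\<phi> ` (pos ` V \<union> X)) \<le> card V + card X"
  proof -
    have "card (\<phi> ` (pos ` V \<union> X)) \<le> card (pos ` V \<union> X)"
      using finite_V finite_X by (intro card_image_le) auto
    also have "\<dots> \<le> card (pos ` V) + card X" by (rule card_Un_le)
    also have "card (pos ` V) \<le> card V" using finite_V by (rule card_image_le)
    finally show ?thesis by simp
  qed
  ultimately show ?thesis using card_H card_uncrossed by linarith
qed

end

theorem theorem31:
  fixes V :: "'v set" and E :: "'e set" and src tgt :: "'e \<Rightarrow> 'v" and n :: nat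
  assumes "multigraph V E src tgt"
    and "connected_graph V E src tgt"
    and "card V = n" and "n \<ge> 3"
    and "non_homotopic_k_planar 1 V E src tgt"
  shows "card E \<le> 4 * n - 8"
proof -
  obtain pos \<gamma> where "drawing V E src tgt pos \<gamma>" "k_planar_drawing 1 E \<gamma>"
      "non_homotopic_drawing V E pos \<gamma>"
    using assms(5) by (auto simp: non_homotopic_k_planar_def)
  then interpret one_planar V E src tgt pos \<gamma>
    using assms by unfold_locales auto
  show ?thesis using edge_bound assms(3) by simp
qed

end
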